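(* Let $F$ be an algebraically closed field of characteristic $\neq 2$, $R=F[t]$ with the involution ${}^*$ described in the context. If $A\in M_n(R)$ is hermitian or skew-hermitian, then $A$ is congruent to a block diagonal direct sum of $1\times 1$ matrices and $2\times 2$ matrices with zero diagonal.
   Context: $R=F[t]$ is the polynomial ring over $F$, and ${}^*$ is the $F$-algebra involution of $R$ that is the identity on $F$ and sends $t$ to $-t$. For $A=(a_{ij})\in M_n(R)$, $A^*$ is the matrix whose $(i,j)$ entry is $a_{ji}^*$. $A$ is hermitian if $A^*=A$ and skew-hermitian if $A^*=-A$. Two such matrices $A,B$ are congruent if $B=S^*AS$ for some $S\in\mathrm{GL}_n(R)$. *)

theory Defs
  imports "HOL-Computational_Algebra.Polynomial" "Jordan_Normal_Form.Matrix"
begin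

definition poly_invol :: "'a::comm_ring_1 poly \<Rightarrow> 'a poly" where
  "poly_invol p = pcompose p [:0, -1:]"

definition star_mat :: "'a::comm_ring_1 poly mat \<Rightarrow> 'a poly mat" where
  "star_mat A = mat (dim_col A) (dim_row A) (\<lambda>(i, j). poly_invol (A $$ (j, i)))"

definition hermitian_pmat :: "'a::comm_ring_1 poly mat \<Rightarrow> bool" where
  "hermitian_pmat A \<longleftrightarrow> star_mat A = A"

definition skew_hermitian_pmat :: "'a::comm_ring_1 poly mat \<Rightarrow> bool" where
  "skew_hermitian_pmat A \<longleftrightarrow> star_mat A = - A"

definition congruent_pmat :: "nat \<Rightarrow> 'a::comm_ring_1 poly mat \<Rightarrow> 'a poly mat \<Rightarrow> bool" where
  "congruent_pmat n A B \<longleftrightarrow>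
     (\<exists>S \<in> carrier_mat n n. invertible_mat S \<and> B = star_mat S * A * S)"

definition admissible_block :: "'a::zero mat \<Rightarrow> bool" where
  "admissible_block M \<longleftrightarrow>
     M \<in> carrier_mat 1 1 \<or>
     (M \<in> carrier_mat 2 2 \<and> M $$ (0, 0) = 0 \<and> M $$ (1, 1) = 0)"

end

theory Submission
  imports Defs
begin

text \<open>
  Since \<open>F\<close> is algebraically closed, every even polynomial is a norm \<open>y y\<^sup>*\<close>; hence every binary
  form has a primitive isotropic vector. Dividing by powers of \<open>t\<close>, which exchanges hermitian and
  skew-hermitian, one may assume that \<open>A\<close> does not vanish at \<open>t = 0\<close>.

  If \<open>A\<close> is hermitian, take a congruent matrix having a diagonal entry \<open>\<alpha>\<close> with \<open>\<alpha>(0) \<noteq> 0\<close> of least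
  degree. Every binary hermitian form with such an entry represents a common divisor of its
  entries that is nonzero at \<open>0\<close>, so by minimality \<open>\<alpha>\<close> divides its row and splits off.

  If \<open>A\<close> is skew-hermitian, take a congruent matrix with \<open>A\<^sub>i\<^sub>i = 0\<close> and \<open>A\<^sub>i\<^sub>j(0) \<noteq> 0\<close> of least degree.
  A change of basis in the plane \<open>i, j\<close> that preserves this degree makes \<open>A\<^sub>j\<^sub>j = 0\<close> as well; by
  minimality \<open>A\<^sub>i\<^sub>j\<close> divides row \<open>i\<close> and \<open>A\<^sub>j\<^sub>i\<close> divides row \<open>j\<close>, so the \<open>2 \<times> 2\<close> block splits off.
\<close>

section \<open>The polynomial ring with involution\<close>

abbreviation st :: "'a::comm_ring_1 poly \<Rightarrow> 'a poly" where
  "st \<equiv> poly_invol"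

definition tvar :: "'a::comm_ring_1 poly" where
  "tvar = [:0, 1:]"

definition lin :: "'a::comm_ring_1 \<Rightarrow> 'a poly" where
  "lin a = [:- a, 1:]"

lemma st_add [simp]: "st (p + q) = st p + st q"
  and st_diff [simp]: "st (p - q) = st p - st q"
  and st_minus [simp]: "st (- p) = - st p"
  and st_mult [simp]: "st (p * q) = st p * st q"
  and st_0 [simp]: "st 0 = 0"
  and st_1 [simp]: "st 1 = 1"
  and st_const [simp]: "st [:c:] = [:c:]"
  and st_tvar [simp]: "st tvar = - tvar"
  by (simp_all add: poly_invol_def pcompose_add pcompose_diff pcompose_uminus pcompose_mult
      pcompose_pCons pcompose_1 tvar_def)

lemma tvar_neq_0 [simp]: "tvar \<noteq> 0"
  and poly_tvar [simp]: "poly tvar x = x"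
  and degree_tvar [simp]: "degree (tvar :: 'a::comm_ring_1 poly) = 1"
  and lin_neq_0 [simp]: "lin a \<noteq> 0"
  and poly_lin [simp]: "poly (lin a) x = x - a"
  and degree_lin [simp]: "degree (lin a) = 1"
  and lin_0: "lin 0 = tvar"
  by (simp_all add: tvar_def lin_def)

lemma st_lin: "st (lin a) = - lin (- a)"
  by (simp add: poly_invol_def lin_def pcompose_pCons)

lemma smult_2: "Polynomial.smult 2 p = p + (p :: 'a::comm_ring_1 poly)"
  unfolding one_add_one [symmetric] smult_add_left by simp

lemma st_sum: "st (sum f A) = (\<Sum>x\<in>A. st (f x))"
  by (simp add: poly_invol_def pcompose_sum)

lemma st_st [simp]: "st (st p) = p"
  unfolding poly_invol_def by (subst pcompose_assoc [symmetric]) (simp add: pcompose_pCons)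

lemma poly_st [simp]: "poly (st p) x = poly p (- x)"
  by (simp add: poly_invol_def poly_pcompose)

lemma degree_st [simp]: "degree (st p) = degree (p :: 'a::idom poly)"
  by (simp add: poly_invol_def degree_pcompose)

lemma st_eq_0_iff [simp]: "st p = 0 \<longleftrightarrow> p = 0"
  by (metis st_0 st_st)

lemma st_dvd_iff: "st p dvd st q \<longleftrightarrow> p dvd q"
proof
  assume "st p dvd st q"
  then obtain k where "st q = st p * k" by blast
  hence "q = p * st k" by (metis st_mult st_st)
  thus "p dvd q" by simp
qed auto

text \<open>\<open>st\<close> is a ring automorphism preserving degrees and divisibility, so it
  carries a division with remainder to another one, and such a division is unique.\<close>

lemma st_div_mod:
  fixes a b :: "'a::field poly"
  shows "st (a div b) = st a div st b" and "st (a mod b) = st a mod st b"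
proof -
  have "(st a div st b, st a mod st b) = (st (a div b), st (a mod b))"
  proof (induction rule: euclidean_relation_polyI)
    case euclidean_relation
    hence "b \<noteq> 0" "a mod b \<noteq> 0" by (auto simp: st_dvd_iff mod_eq_0_iff_dvd)
    thus ?case using degree_mod_less [of b a] by (simp flip: st_mult st_add)
  qed (auto simp: st_dvd_iff simp flip: st_mult)
  thus "st (a div b) = st a div st b" "st (a mod b) = st a mod st b" by auto
qed

section \<open>Even and odd polynomials, their roots, and norms\<close>

lemma even_quotient:
  assumes "a = b * q" "st a = a" "st b = b" "(b :: 'a::idom poly) \<noteq> 0"
  shows "st q = q"
proof -
  have "b * st q = b * q" using assms st_mult [of b q] by simp
  thus ?thesis using assms(4) by simp
qed

lemma odd_poly_zero:
  fixes p :: "'a::field poly"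
  assumes "(2::'a) \<noteq> 0" "st p = - p"
  shows "poly p 0 = 0"
proof -
  have "poly p 0 = - poly p 0" using poly_st [of p 0] assms(2) by simp
  hence "2 * poly p 0 = 0" by (metis add.right_inverse mult_2)
  thus ?thesis using assms(1) by simp
qed

lemma tvar_factor:
  assumes "poly (p :: 'a::idom poly) 0 = 0"
  obtains q where "p = tvar * q"
proof -
  have "tvar dvd p" using assms by (simp add: poly_eq_0_iff_dvd tvar_def)
  thus ?thesis using that by blast
qed

lemma odd_factor:
  fixes p :: "'a::field poly"
  assumes "(2::'a) \<noteq> 0" "st p = - p"
  obtains q where "p = tvar * q" "st q = q"
proof -
  obtain q where q: "p = tvar * q" using tvar_factor odd_poly_zero assms by metis
  have "tvar * st q = tvar * q" using assms(2) unfolding q st_mult st_tvar by simp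
  hence "st q = q" by (metis mult_left_cancel tvar_neq_0)
  with q that show ?thesis by blast
qed

text \<open>\<open>t\<close> is prime and does not divide \<open>g\<close>, so it divides the
  cofactor.\<close>

lemma dvd_tvar_cancel:
  assumes "g dvd tvar * z" "poly (g :: 'a::idom poly) 0 \<noteq> 0"
  shows "g dvd z"
proof -
  obtain k where k: "tvar * z = g * k" using assms(1) by blast
  have "poly (tvar * z) 0 = 0" by simp
  hence "poly k 0 = 0" using assms(2) unfolding k by simp
  then obtain k' where "k = tvar * k'" by (rule tvar_factor)
  hence "tvar * z = tvar * (g * k')" using k by (simp add: mult.left_commute)
  hence "z = g * k'" by (metis mult_left_cancel tvar_neq_0)
  thus ?thesis by simp
qed

text \<open>Nonzero roots of an even polynomial come in pairs \<open>a\<close>, \<open>-a\<close>,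
  and the root \<open>0\<close> has even multiplicity. The sign in
  \<open>st (lin a) = - lin (- a)\<close> is absorbed by \<open>q\<close>.\<close>

lemma even_root_factor:
  fixes p :: "'a::field poly"
  assumes two: "(2::'a) \<noteq> 0" and p: "st p = p" "poly p a = 0"
  obtains q where "p = lin a * st (lin a) * q" "st q = q"
proof -
  let ?l = "lin a"
  obtain q where q: "p = ?l * q"
    using p(2) by (auto simp: poly_eq_0_iff_dvd lin_def elim: dvdE)
  have "poly q (- a) = 0"
  proof (cases "a = 0")
    case True
    have "tvar * q = tvar * (- st q)"
      using p(1) unfolding q True lin_0 by simp
    hence "q = - st q" by (metis mult_left_cancel tvar_neq_0)
    hence "st q = - q" by (metis minus_minus)
    with odd_poly_zero two True show ?thesis by simp
  next
    case False
    have "poly p (- a) = 0" using p poly_st [of p a] by simp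
    thus ?thesis using False two unfolding q by simp
  qed
  then obtain r where r: "q = lin (- a) * r"
    by (auto simp: poly_eq_0_iff_dvd lin_def elim: dvdE)
  have eq: "p = ?l * st ?l * (- r)" unfolding q r st_lin by simp
  have "?l * st ?l \<noteq> 0" by simp
  from even_quotient [OF eq p(1) _ this] have "st (- r) = - r" by (simp add: mult.commute)
  with eq show ?thesis by (rule that)
qed

text \<open>Constants are squares, and a root \<open>a\<close> splits off the norm of
  \<open>lin a\<close>, leaving an even cofactor of smaller degree.\<close>

lemma norm_poly_surj:
  fixes r :: "'a::alg_closed_field poly"
  assumes two: "(2::'a) \<noteq> 0" and "st r = r"
  shows "\<exists>y. y * st y = r"
  using assms(2)
proof (induction "degree r" arbitrary: r rule: less_induct)
  case less
  show ?case
  proof (cases "degree r = 0")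
    case True
    then obtain c where c: "r = [:c:]" by (metis degree_eq_zeroE)
    obtain d where "d ^ 2 = c" using nth_root_exists [of 2 c] by auto
    hence "[:d:] * st [:d:] = r" unfolding c by (simp add: power2_eq_square)
    thus ?thesis by blast
  next
    case False
    then obtain a where a: "poly r a = 0" using alg_closed_imp_poly_has_root by blast
    let ?l = "lin a"
    obtain q where q: "r = ?l * st ?l * q" "st q = q"
      using even_root_factor [OF two less.prems a] .
    have "q \<noteq> 0" using False q by auto
    hence "degree r = degree ?l + degree ?l + degree q" unfolding q(1)
      by (simp add: degree_mult_eq)
    hence "degree q < degree r" by simp
    from less.hyps [OF this q(2)] obtain y where "y * st y = q" by blast
    hence "r = ?l * st ?l * (y * st y)" using q(1) by simp
    also have "\<dots> = (?l * y) * st (?l * y)" by simp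
    finally have "(?l * y) * st (?l * y) = r" ..
    thus ?thesis by blast
  qed
qed

section \<open>Generators, Bezout identities and trace ideals\<close>

text \<open>Division by an element of least degree leaves only zero remainders. The hypothesis is
  closure under \<open>mod\<close> because the sets \<open>J\<close> of \<open>bezout_even\<close>
  and \<open>trace_generator\<close> consist of even polynomials and are not ideals of
  \<open>F[t]\<close>.\<close>

lemma mod_closed_generator:
  fixes J :: "'a::field poly set"
  assumes "\<And>a b. a \<in> J \<Longrightarrow> b \<in> J \<Longrightarrow> a mod b \<in> J" and "j \<in> J" "j \<noteq> 0"
  shows "\<exists>g\<in>J. g \<noteq> 0 \<and> (\<forall>a\<in>J. g dvd a)"
proof -
  define g where "g = arg_min degree (\<lambda>p. p \<in> J \<and> p \<noteq> 0)"
  have g: "g \<in> J" "g \<noteq> 0" and min: "\<And>p. p \<in> J \<Longrightarrow> p \<noteq> 0 \<Longrightarrow> degree g \<le> degree p"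
    using arg_min_nat_lemma [of "\<lambda>p. p \<in> J \<and> p \<noteq> 0" j degree] assms(2,3)
    unfolding g_def by auto
  have "g dvd a" if "a \<in> J" for a
  proof (rule ccontr)
    assume "\<not> g dvd a"
    hence "a mod g \<noteq> 0" by (simp add: mod_eq_0_iff_dvd)
    moreover from this have "degree (a mod g) < degree g"
      using degree_mod_less [OF g(2), of a] by simp
    moreover have "a mod g \<in> J" using assms(1) that g(1) by blast
    ultimately show False using min [of "a mod g"] by simp
  qed
  with g show ?thesis by blast
qed

lemma bezout_poly:
  fixes a b :: "'a::field poly"
  shows "\<exists>d x y. d dvd a \<and> d dvd b \<and> d = x * a + y * b"
proof (cases "a = 0 \<and> b = 0")
  case False
  define J where "J = {x * a + y * b | x y. True}"
  have ab: "a \<in> J" "b \<in> J" unfolding J_def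
    by (force intro: exI [of _ 1] exI [of _ 0])+
  have "u mod v \<in> J" if uv: "u \<in> J" "v \<in> J" for u v
  proof -
    obtain x y x' y' where "u = x * a + y * b" "v = x' * a + y' * b" using uv J_def by auto
    hence "u mod v = (x - u div v * x') * a + (y - u div v * y') * b"
      unfolding minus_div_mult_eq_mod [symmetric] by (simp add: algebra_simps)
    thus ?thesis unfolding J_def by blast
  qed
  from mod_closed_generator [of J, OF this] False ab
  obtain g where "g \<in> J" "\<forall>a\<in>J. g dvd a" by metis
  with ab show ?thesis unfolding J_def by blast
qed (auto intro: exI [of _ 0])

text \<open>Quotients of even polynomials are even, so Euclidean division keeps the coefficients
  even. Only even coefficients can be norms.\<close>

lemma bezout_even:
  fixes a b :: "'a::field poly"
  assumes st: "st a = a" "st b = b"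
  shows "\<exists>d x y. d dvd a \<and> d dvd b \<and> d = x * a + y * b \<and> st x = x \<and> st y = y"
proof (cases "a = 0 \<and> b = 0")
  case False
  define J where "J = {x * a + y * b | x y. st x = x \<and> st y = y}"
  have "1 * a + 0 * b \<in> J" "0 * a + 1 * b \<in> J" unfolding J_def mem_Collect_eq
    by (metis st_0 st_1)+
  hence ab: "a \<in> J" "b \<in> J" by auto
  have "u mod v \<in> J" if uv: "u \<in> J" "v \<in> J" for u v
  proof -
    obtain x y x' y' where *: "u = x * a + y * b" "v = x' * a + y' * b"
      "st x = x" "st y = y" "st x' = x'" "st y' = y'" using uv J_def by auto
    have eq: "u mod v = (x - u div v * x') * a + (y - u div v * y') * b"
      unfolding minus_div_mult_eq_mod [symmetric] using *(1,2) by (simp add: algebra_simps)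
    have "st u = u" "st v = v" using * st by simp_all
    hence "st (x - u div v * x') = x - u div v * x'" "st (y - u div v * y') = y - u div v * y'"
      using * by (simp_all add: st_div_mod)
    with eq show ?thesis unfolding J_def by blast
  qed
  from mod_closed_generator [of J, OF this] False ab
  obtain g where "g \<in> J" "\<forall>a\<in>J. g dvd a" by metis
  with ab show ?thesis unfolding J_def by blast
next
  case True
  thus ?thesis by (intro exI [of _ 0]) simp
qed

text \<open>Dividing a nonzero vector by its gcd makes it primitive, hence the first vector of a
  basis of determinant 1.\<close>

lemma coprime_part:
  fixes p q :: "'a::field poly"
  assumes "\<not> (p = 0 \<and> q = 0)"
  obtains e p' q' u v where "e \<noteq> 0" "p = e * p'" "q = e * q'" "u * p' + v * q' = 1"
proof -
  obtain e u v where e: "e dvd p" "e dvd q" "e = u * p + v * q" using bezout_poly by blast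
  obtain p' q' where pq: "p = e * p'" "q = e * q'" using e(1,2) by (auto elim!: dvdE)
  have "e \<noteq> 0" using assms pq by auto
  moreover have "e * 1 = e * (u * p' + v * q')" using e(3) pq by (simp add: algebra_simps)
  ultimately have "u * p' + v * q' = 1" by (metis mult_left_cancel)
  with pq \<open>e \<noteq> 0\<close> that show ?thesis by blast
qed

text \<open>The traces of multiples of \<open>b\<close> form a module over the even polynomials, and
  the quotient of two traces is even, so they are closed under \<open>mod\<close>. The multiple
  \<open>st b * b\<close> has the nonzero trace \<open>2 * b * st b\<close>.\<close>

lemma trace_generator:
  fixes b :: "'a::field poly"
  assumes two: "(2::'a) \<noteq> 0" and "b \<noteq> 0"
  obtains h x where "h \<noteq> 0" "st h = h" "x * b + st (x * b) = h"
    "\<And>z. h dvd z * b + st (z * b)"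
proof -
  define J where "J = {z * b + st (z * b) | z. True}"
  have J: "z * b + st (z * b) \<in> J" for z unfolding J_def by blast
  have even: "st u = u" if "u \<in> J" for u using that J_def by (auto simp: add.commute)
  have "u mod v \<in> J" if uv: "u \<in> J" "v \<in> J" for u v
  proof -
    obtain x y where *: "u = x * b + st (x * b)" "v = y * b + st (y * b)"
      using uv J_def by auto
    have "st (u div v) = u div v" using even uv by (simp add: st_div_mod)
    hence "u mod v = (x - u div v * y) * b + st ((x - u div v * y) * b)"
      unfolding minus_div_mult_eq_mod [symmetric] st_mult st_diff
      using * by (simp add: algebra_simps)
    thus ?thesis using J by metis
  qed
  moreover have "\<exists>j\<in>J. j \<noteq> 0"
  proof -
    have "st b * b + st (st b * b) = Polynomial.smult 2 (b * st b)"
      by (simp add: smult_2 mult.commute)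
    moreover have "Polynomial.smult 2 (b * st b) \<noteq> 0" using assms by simp
    ultimately show ?thesis using J by metis
  qed
  ultimately obtain h where h: "h \<in> J" "h \<noteq> 0" "\<forall>a\<in>J. h dvd a"
    using mod_closed_generator [of J] by blast
  then obtain x where "x * b + st (x * b) = h" unfolding J_def by blast
  with h J even that show ?thesis by blast
qed

text \<open>As \<open>t\<close> is odd, \<open>t\<close> times the trace of \<open>b\<close> plus
  the trace of \<open>t b\<close> equals \<open>2 t b\<close>; \<open>h\<close> divides this and is
  prime to \<open>t\<close>.\<close>

lemma trace_generator_dvd:
  fixes b :: "'a::field poly"
  assumes two: "(2::'a) \<noteq> 0" and h: "\<And>z. h dvd z * b + st (z * b)" "poly h 0 \<noteq> 0"
  shows "h dvd b"
proof -
  have "h dvd tvar * (1 * b + st (1 * b)) + (tvar * b + st (tvar * b))"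
    by (intro dvd_add dvd_mult h)
  also have "\<dots> = tvar * Polynomial.smult 2 b"
    by (simp add: smult_2 algebra_simps)
  finally have "h dvd Polynomial.smult 2 b" using h(2) dvd_tvar_cancel by blast
  thus ?thesis using two by (simp add: dvd_smult_iff)
qed

text \<open>
  The trace ideal of \<open>b\<close> is unchanged when \<open>b\<close> is multiplied by a suitable element of norm
  \<open>r\<close>. For each root \<open>a\<close> of \<open>r\<close> one may use \<open>t - a\<close> or \<open>t + a\<close>: the traces of
  \<open>(t + a) x b\<close> and \<open>(t - a) x b\<close> differ by \<open>2 a h\<close>, so at least one of them is \<open>h m\<close> with
  \<open>m(a) \<noteq> 0\<close>, and then \<open>h\<close> is recovered modulo the traces of multiples of \<open>t\<^sup>2 - a\<^sup>2\<close>.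
\<close>
lemma norm_with_trace:
  fixes b :: "'a::alg_closed_field poly"
  assumes two: "(2::'a) \<noteq> 0" and h: "h \<noteq> 0" "st h = h" "x * b + st (x * b) = h"
    "\<And>z. h dvd z * b + st (z * b)"
    and r: "st r = r" "poly r 0 \<noteq> 0"
  shows "\<exists>y x. y * st y = r \<and> x * (y * b) + st (x * (y * b)) = h"
  using r
proof (induction "degree r" arbitrary: r rule: less_induct)
  case less
  show ?case
  proof (cases "degree r = 0")
    case True
    then obtain c where c: "r = [:c:]" by (metis degree_eq_zeroE)
    obtain d where d: "d ^ 2 = c" using nth_root_exists [of 2 c] by auto
    hence "d \<noteq> 0" using less.prems c by auto
    hence "[:1/d:] * ([:d:] * b) = b" by simp
    hence "(x * [:1/d:]) * ([:d:] * b) + st ((x * [:1/d:]) * ([:d:] * b)) = h"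
      using h(3) by (metis mult.assoc)
    moreover have "[:d:] * st [:d:] = r" using d unfolding c by (simp add: power2_eq_square)
    ultimately show ?thesis by blast
  next
    case False
    then obtain a where a: "poly r a = 0" using alg_closed_imp_poly_has_root by blast
    hence "a \<noteq> 0" using less.prems by auto
    let ?l = "lin a"
    obtain q where q: "r = ?l * st ?l * q" "st q = q"
      using even_root_factor [OF two less.prems(1) a] .
    have "q \<noteq> 0" using False q by auto
    hence "degree r = degree ?l + degree ?l + degree q" unfolding q(1)
      by (simp add: degree_mult_eq)
    hence deg: "degree q < degree r" by simp
    have "poly q 0 \<noteq> 0" using less.prems(2) unfolding q(1) by auto
    from less.hyps [OF deg q(2) this]
    obtain y x where y: "y * st y = q" "x * (y * b) + st (x * (y * b)) = h" by blast
    have key: "\<exists>z. z * (k * y * b) + st (z * (k * y * b)) = h"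
      if k: "k * st k = ?l * st ?l" and m: "x * (k * y * b) + st (x * (k * y * b)) = h * m"
        and ma: "poly m a \<noteq> 0" for k m
    proof -
      have "st (h * m) = h * m" unfolding m [symmetric] by (simp add: add.commute)
      hence "st m = m" using even_quotient h(1,2) by blast
      hence "st (m - [:poly m a:]) = m - [:poly m a:]" by simp
      then obtain m' where m': "m - [:poly m a:] = ?l * st ?l * m'" "st m' = m'"
        by (rule even_root_factor [OF two, of _ a]) auto
      define C where "C = [:poly m a:]"
      define D where "D = [:1 / poly m a:]"
      have CD: "D * C = 1" "st D = D" using ma by (simp_all add: C_def D_def one_pCons)
      \<comment> \<open>Subtracting \<open>x * m' * st k\<close> removes from the trace
        \<open>h m\<close> the part divisible by \<open>k * st k\<close>. What remains is
        \<open>h\<close> times the constant \<open>m(a)\<close>, which \<open>D\<close> normalises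
        to \<open>h\<close>.\<close>
      let ?z = "D * (x - x * m' * st k)"
      have "?z * (k * y * b) + st (?z * (k * y * b)) =
          D * ((x * (k * y * b) + st (x * (k * y * b)))
            - k * st k * m' * (x * (y * b) + st (x * (y * b))))"
        unfolding st_mult st_diff CD(2) st_st m'(2) by (simp add: algebra_simps)
      also have "\<dots> = h * (D * (m - ?l * st ?l * m'))"
        unfolding m y k by (simp add: algebra_simps)
      also have "m - ?l * st ?l * m' = C" unfolding m'(1) [symmetric] C_def by simp
      finally show ?thesis using CD(1) by (metis mult.right_neutral)
    qed
    have dv: "\<exists>m. x * (k * y * b) + st (x * (k * y * b)) = h * m" for k
      using h(4) [of "x * (k * y)"] by (metis dvdE mult.assoc)
    obtain m1 where m1: "x * (?l * y * b) + st (x * (?l * y * b)) = h * m1" using dv by blast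
    \<comment> \<open>\<open>- st ?l\<close> is \<open>t + a\<close>, which has the same norm as
      \<open>t - a\<close>.\<close>
    obtain m2 where m2: "x * ((- st ?l) * y * b) + st (x * ((- st ?l) * y * b)) = h * m2"
      using dv by blast
    have "h * (m2 - m1) = (- st ?l - ?l) * (x * (y * b) + st (x * (y * b)))"
      unfolding right_diff_distrib m1 [symmetric] m2 [symmetric]
      by (simp add: algebra_simps)
    also have "- st ?l - ?l = [:2 * a:]" unfolding st_lin by (simp add: lin_def)
    also have "[:2 * a:] * (x * (y * b) + st (x * (y * b))) = h * [:2 * a:]"
      unfolding y by (rule mult.commute)
    finally have "m2 - m1 = [:2 * a:]" using h(1) by (metis mult_left_cancel)
    hence "poly m2 a - poly m1 a = poly [:2 * a:] a" by (metis poly_diff)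
    hence "poly m1 a \<noteq> 0 \<or> poly m2 a \<noteq> 0" using two \<open>a \<noteq> 0\<close> by auto
    then obtain k where k: "k * st k = ?l * st ?l"
      "\<exists>z. z * (k * y * b) + st (z * (k * y * b)) = h"
      using key [OF refl m1] key [OF _ m2]
      by (metis minus_mult_minus mult.commute st_minus st_st)
    have "(k * y) * st (k * y) = (k * st k) * (y * st y)" by simp
    also have "\<dots> = r" unfolding k y q(1) ..
    finally show ?thesis using k(2) by blast
  qed
qed

section \<open>Binary forms\<close>

text \<open>
  The value on \<open>(x, y), (z, w)\<close> of the sesquilinear form with Gram matrix \<open>((a, f), (g, d))\<close>,
  conjugate-linear in the first vector.
\<close>
definition form ::
  "'a::comm_ring_1 poly \<Rightarrow> 'a poly \<Rightarrow> 'a poly \<Rightarrow> 'a poly \<Rightarrow>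
   'a poly \<Rightarrow> 'a poly \<Rightarrow> 'a poly \<Rightarrow> 'a poly \<Rightarrow> 'a poly" where
  "form a f g d x y z w = st x * z * a + st x * w * f + st y * z * g + st y * w * d"

lemma form_change_basis:
  "form a f g d (X * x + Y * z) (X * y + Y * w) (X' * x + Y' * z) (X' * y + Y' * w) =
   form (form a f g d x y x y) (form a f g d x y z w)
     (form a f g d z w x y) (form a f g d z w z w) X Y X' Y'"
  by (simp add: form_def algebra_simps)

lemma form_scale:
  "form a f g d (e * x) (e * y) (e * x) (e * y) = st e * e * form a f g d x y x y"
  by (simp add: form_def algebra_simps)

lemma form_swap:
  assumes "e * e = 1" "st a = e * a" "st d = e * d" "g = e * st f" "st e = e"
  shows "form a f g d z w x y = e * st (form a f g d x y z w)"
proof -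
  have e: "e * (e * p) = p" for p by (simp add: assms(1) flip: mult.assoc)
  show ?thesis using assms(2-5) by (simp add: form_def algebra_simps e)
qed

text \<open>
  The vector \<open>(- f, a)\<close> is orthogonal to \<open>(1, 0)\<close> and its value is \<open>a\<close> times an even polynomial;
  as the negative of that polynomial is a norm \<open>N(X)\<close>, the vector \<open>(X - f, a)\<close> is isotropic.
\<close>
lemma isotropic_vector:
  fixes a :: "'a::alg_closed_field poly"
  assumes two: "(2::'a) \<noteq> 0"
    and e: "e * e = 1" "st e = e" and st: "st a = e * a" "st d = e * d" "g = e * st f"
  obtains x y u v where "u * x + v * y = 1" "form a f g d x y x y = 0"
proof (cases "a = 0")
  case True
  hence "form a f g d 1 0 1 0 = 0" by (simp add: form_def)
  thus ?thesis using that [of 1 1 0 0] by simp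
next
  case False
  have ee: "e * (e * p) = p" for p by (simp add: e(1) flip: mult.assoc)
  have "st (f * st f - e * a * d) = f * st f - e * a * d"
    using e st by (simp add: algebra_simps ee)
  then obtain X where X: "X * st X = f * st f - e * a * d"
    using norm_poly_surj [OF two] by blast
  have "form a f g d (X - f) a (X - f) a = a * (X * st X - (f * st f - e * a * d))"
    unfolding form_def st by (simp add: algebra_simps ee)
  hence 0: "form a f g d (X - f) a (X - f) a = 0" unfolding X by simp
  \<comment> \<open>Dividing by the gcd makes the vector primitive; by \<open>form_scale\<close> its
    value is still 0.\<close>
  obtain k x y u v where k: "k \<noteq> 0" "X - f = k * x" "a = k * y" "u * x + v * y = 1"
    using coprime_part [of "X - f" a] False by blast
  have "form a f g d (k * x) (k * y) (k * x) (k * y) = 0"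
    using 0 unfolding k(2) k(3) [symmetric] .
  hence "form a f g d x y x y = 0" using k(1) unfolding form_scale by simp
  with k(4) show ?thesis by (rule that)
qed

text \<open>
  The value represented is \<open>gcd c h = r c + k h\<close>, where \<open>h\<close> generates the trace ideal of \<open>b\<close>:
  the term \<open>r c\<close> requires \<open>r = N(Y)\<close>, and \<open>Y\<close> can be chosen so that \<open>Y b\<close> still has the trace \<open>h\<close>.
\<close>
lemma isotropic_hermitian_value:
  fixes b :: "'a::alg_closed_field poly"
  assumes two: "(2::'a) \<noteq> 0" and c: "st c = c"
  obtains X Y where "form 0 b (st b) c X Y X Y dvd c"
    "\<And>z. form 0 b (st b) c X Y X Y dvd z * b + st (z * b)"
proof (cases "b = 0")
  case True
  have "form 0 b (st b) c 0 1 0 1 = c" by (simp add: form_def)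
  thus ?thesis using that [of 0 1] True by simp
next
  case False
  obtain h x where h: "h \<noteq> 0" "st h = h" "x * b + st (x * b) = h"
    "\<And>z. h dvd z * b + st (z * b)"
    using trace_generator [OF two False] by blast
  obtain d r k where d: "d dvd c" "d dvd h" "d = r * c + k * h" "st r = r" "st k = k"
    using bezout_even [OF c h(2)] by blast
  obtain c' h' where c': "c = d * c'" "h = d * h'" using d(1,2) by (metis dvdE)
  have "d \<noteq> 0" using h c' by auto
  have "st d = d" using d(3-5) c h(2) by simp
  hence st': "st c' = c'" "st h' = h'" using even_quotient c' c h(2) \<open>d \<noteq> 0\<close> by blast+
  have "d * 1 = d * (r * c' + k * h')" using d(3) unfolding c' by (simp add: algebra_simps)
  hence one: "r * c' + k * h' = 1" using \<open>d \<noteq> 0\<close> by (metis mult_left_cancel)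
  \<comment> \<open>\<open>norm_with_trace\<close> asks for \<open>r(0) \<noteq> 0\<close>. If
    \<open>r(0) = 0\<close>, then \<open>h'(0) \<noteq> 0\<close>, and \<open>r + h'\<close>,
    \<open>k - c'\<close> satisfy the same identity.\<close>
  have "\<exists>r k. st r = r \<and> st k = k \<and> poly r 0 \<noteq> 0 \<and> r * c' + k * h' = 1"
  proof (cases "poly r 0 = 0")
    case True
    have "poly (r * c' + k * h') 0 = 1" unfolding one by simp
    hence "poly (r + h') 0 \<noteq> 0" using True by auto
    moreover have "(r + h') * c' + (k - c') * h' = 1" using one by (simp add: algebra_simps)
    moreover have "st (r + h') = r + h'" "st (k - c') = k - c'" using st' d by simp_all
    ultimately show ?thesis by blast
  qed (use one d in blast)
  then obtain r k where r: "st r = r" "st k = k" "poly r 0 \<noteq> 0" "r * c' + k * h' = 1" by blast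
  obtain y x where y: "y * st y = r" "x * (y * b) + st (x * (y * b)) = h"
    using norm_with_trace [OF two h r(1) r(3)] by blast
  have "form 0 b (st b) c (st (k * x)) y (st (k * x)) y
      = k * (x * (y * b) + st (x * (y * b))) + y * st y * c"
    using r(2) by (simp add: form_def algebra_simps)
  also have "\<dots> = d * (r * c' + k * h')" unfolding y c' by (simp add: algebra_simps)
  also have "\<dots> = d" unfolding r(4) by simp
  finally have "form 0 b (st b) c (st (k * x)) y (st (k * x)) y = d" .
  with d(1) dvd_trans [OF d(2) h(4)] show ?thesis using that by metis
qed

text \<open>In a basis starting with an isotropic vector the form is \<open>0, b, st b, c\<close>.
  The value \<open>m\<close> from \<open>isotropic_hermitian_value\<close> divides \<open>c\<close>
  and all traces of multiples of \<open>b\<close>. As \<open>a\<close> is such a trace plus a norm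
  times \<open>c\<close>, \<open>m\<close> divides \<open>a\<close>; so
  \<open>m(0) \<noteq> 0\<close>, and \<open>trace_generator_dvd\<close> shows that \<open>m\<close>
  divides \<open>b\<close>, hence all values of the form.\<close>

lemma hermitian_binary_value:
  fixes a :: "'a::alg_closed_field poly"
  assumes two: "(2::'a) \<noteq> 0"
    and st: "st a = a" "st d = d" "g = st f" and a0: "poly a 0 \<noteq> 0"
  obtains p q r s where "p * s - q * r = 1" "poly (form a f g d p q p q) 0 \<noteq> 0"
    "form a f g d p q p q dvd a" "form a f g d p q p q dvd f"
proof -
  obtain x y u v where xy: "u * x + v * y = 1" "form a f g d x y x y = 0"
    by (rule isotropic_vector [OF two, of 1 a d g f]) (use st in auto)
  define b where "b = form a f g d x y (- v) u"
  define c where "c = form a f g d (- v) u (- v) u"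
  have sw: "form a f g d z w z' w' = st (form a f g d z' w' z w)" for z w z' w'
  proof -
    have "form a f g d z w z' w' = 1 * st (form a f g d z' w' z w)"
      by (rule form_swap) (simp_all add: st)
    thus ?thesis by simp
  qed
  have stc: "st c = c" unfolding c_def by (rule sw [symmetric])
  have basis: "form a f g d (X * x + Y * - v) (X * y + Y * u) (X' * x + Y' * - v) (X' * y + Y' * u)
      = form 0 b (st b) c X Y X' Y'" for X Y X' Y'
    unfolding form_change_basis xy(2) b_def c_def sw [of "- v" u x y] ..
  \<comment> \<open>These are the coordinates of the original basis vectors in the new
    basis.\<close>
  have e1: "u * x + (- y) * - v = 1" "u * y + (- y) * u = 0"
    and e2: "v * x + x * - v = 0" "v * y + x * u = 1"
    using xy(1) by (simp_all add: algebra_simps)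
  have a: "a = form 0 b (st b) c u (- y) u (- y)"
    using basis [of u "- y" u "- y"] unfolding e1 by (simp add: form_def)
  have f: "f = form 0 b (st b) c u (- y) v x"
    using basis [of u "- y" v x] unfolding e1 e2 by (simp add: form_def)
  obtain X Y where XY: "form 0 b (st b) c X Y X Y dvd c"
    "\<And>z. form 0 b (st b) c X Y X Y dvd z * b + st (z * b)"
    using isotropic_hermitian_value [OF two stc, of b] by blast
  define m where "m = form 0 b (st b) c X Y X Y"
  note XY = XY [folded m_def]
  have "a = (st u * (- y)) * b + st ((st u * (- y)) * b) + c * (y * st y)"
    unfolding form_def a by (simp add: algebra_simps)
  hence "m dvd a" by (metis XY dvd_add dvd_mult2)
  hence m0: "poly m 0 \<noteq> 0" using a0 by auto
  have mb: "m dvd b" using trace_generator_dvd [OF two _ m0] XY(2) by blast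
  have "m dvd st b" using XY(2) [of 1] mb by (simp add: dvd_add_right_iff)
  hence "m dvd f" unfolding f form_def using mb XY(1) by (intro dvd_add dvd_mult) auto
  have m: "m = form a f g d (X * x + Y * - v) (X * y + Y * u) (X * x + Y * - v) (X * y + Y * u)"
    unfolding m_def basis ..
  \<comment> \<open>A vector of nonzero value is nonzero; making it primitive replaces
    \<open>m\<close> by a divisor of \<open>m\<close>.\<close>
  have "\<not> (X * x + Y * - v = 0 \<and> X * y + Y * u = 0)"
  proof
    assume *: "X * x + Y * - v = 0 \<and> X * y + Y * u = 0"
    have "m = 0" unfolding m * [THEN conjunct1] * [THEN conjunct2] by (simp add: form_def)
    with m0 show False by simp
  qed
  then obtain k p q s t where k: "k \<noteq> 0" "X * x + Y * - v = k * p" "X * y + Y * u = k * q"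
    "s * p + t * q = 1" using coprime_part by blast
  have mk: "m = st k * k * form a f g d p q p q" unfolding m k form_scale ..
  have "p * s - q * (- t) = 1" using k(4) by (simp add: algebra_simps)
  moreover have "poly (form a f g d p q p q) 0 \<noteq> 0" using m0 unfolding mk by auto
  moreover have "form a f g d p q p q dvd m" unfolding mk by simp
  ultimately show ?thesis using that \<open>m dvd a\<close> \<open>m dvd f\<close> dvd_trans by blast
qed

text \<open>Odd diagonal entries vanish at 0, so at \<open>t = 0\<close> the form is alternating,
  and a base change of determinant 1 keeps its off-diagonal value \<open>f(0)\<close>.\<close>

lemma skew_isotropic_basis:
  fixes a :: "'a::alg_closed_field poly"
  assumes two: "(2::'a) \<noteq> 0"
    and st: "st a = - a" "st d = - d" "g = - st f" and f0: "poly f 0 \<noteq> 0"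
  obtains p q r s where "p * s - q * r = 1" "form a f g d p q p q = 0"
    "poly (form a f g d p q r s) 0 \<noteq> 0"
proof -
  obtain x y u v where xy: "u * x + v * y = 1" "form a f g d x y x y = 0"
    by (rule isotropic_vector [OF two, of "- 1" a d g f]) (use st in auto)
  have "poly a 0 = 0" "poly d 0 = 0" using odd_poly_zero two st by blast+
  hence "poly (form a f g d x y (- v) u) 0 = poly ((u * x + v * y) * f) 0"
    unfolding form_def st by (simp add: algebra_simps)
  also have "\<dots> \<noteq> 0" unfolding xy using f0 by simp
  finally have "poly (form a f g d x y (- v) u) 0 \<noteq> 0" .
  moreover have "x * u - y * (- v) = 1" using xy(1) by (simp add: algebra_simps)
  ultimately show ?thesis using xy(2) that by blast
qed

text \<open>
  Write \<open>b = h b'\<close> with \<open>h\<close> the trace generator, \<open>c = t c0\<close>, \<open>d = gcd h c0\<close> and \<open>k = h / d = N(y)\<close>.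
  The isotropic vector \<open>(st z, y)\<close> trades the factor \<open>k = y y\<^sup>*\<close> of \<open>b\<close> for \<open>(y\<^sup>*)\<^sup>2\<close>, so
  that the new off-diagonal entry \<open>\<beta>\<close> has trace generator \<open>d\<close>. As \<open>d\<close> divides all values of the
  form, the remaining diagonal entry can be cleared.
\<close>
lemma skew_hyperbolic_basis:
  fixes b :: "'a::alg_closed_field poly"
  assumes two: "(2::'a) \<noteq> 0" and c: "st c = - c" and b0: "poly b 0 \<noteq> 0"
  obtains p q r s where "p * s - q * r = 1"
    "form 0 b (- st b) c p q p q = 0" "form 0 b (- st b) c r s r s = 0"
    "poly (form 0 b (- st b) c p q r s) 0 \<noteq> 0"
    "degree (form 0 b (- st b) c p q r s) = degree b"
proof -
  have "b \<noteq> 0" using b0 by auto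
  obtain h x where h: "h \<noteq> 0" "st h = h" "x * b + st (x * b) = h"
    "\<And>z. h dvd z * b + st (z * b)"
    using trace_generator [OF two \<open>b \<noteq> 0\<close>] by blast
  \<comment> \<open>\<open>h\<close> divides the trace of \<open>b\<close>, whose value at 0 is
    \<open>2 b(0)\<close>; hence \<open>h(0) \<noteq> 0\<close> and \<open>h\<close> divides
    \<open>b\<close>.\<close>
  have "poly (1 * b + st (1 * b)) 0 = 2 * poly b 0" by simp
  hence "poly (1 * b + st (1 * b)) 0 \<noteq> 0" using two b0 by simp
  hence "poly h 0 \<noteq> 0" using h(4) [of 1] by (metis dvd_def mult_zero_left poly_mult)
  then obtain b' where b': "b = h * b'"
    using trace_generator_dvd [OF two h(4)] by blast
  have "h * (x * b' + st (x * b')) = h * 1" using h(2,3) unfolding b' by (simp add: algebra_simps)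
  hence one: "x * b' + st (x * b') = 1" using h(1) by (metis mult_left_cancel)
  obtain c0 where c0: "c = tvar * c0" "st c0 = c0" using odd_factor [OF two c] .
  obtain d i j where d: "d dvd h" "d dvd c0" "d = i * h + j * c0" "st i = i" "st j = j"
    using bezout_even [OF h(2) c0(2)] by blast
  obtain k c1 where k: "h = d * k" "c0 = d * c1" using d(1,2) by (metis dvdE)
  have "d \<noteq> 0" using h k by auto
  have std: "st d = d" using d c0 h by simp
  have st': "st k = k" "st c1 = c1" using even_quotient k h(2) c0(2) std \<open>d \<noteq> 0\<close> by blast+
  have "d * (i * k + j * c1) = d * 1" using d(3) unfolding k by (simp add: algebra_simps)
  hence ij: "i * k + j * c1 = 1" using \<open>d \<noteq> 0\<close> by (metis mult_left_cancel)
  have k0: "poly k 0 \<noteq> 0" using \<open>poly h 0 \<noteq> 0\<close> k by auto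
  \<comment> \<open>The traces of multiples of \<open>b'\<close> are generated by 1, so some
    \<open>y\<close> of norm \<open>k\<close> has a multiple of \<open>y b'\<close> with trace
    1.\<close>
  obtain y x1 where y: "y * st y = k" "x1 * (y * b') + st (x1 * (y * b')) = 1"
    using norm_with_trace [OF two _ _ one _ st'(1) k0] by auto
  have "y \<noteq> 0" using y(1) k0 by auto
  \<comment> \<open>As \<open>c = - d m\<close>, the vector \<open>(st z, y)\<close> has value
    \<open>h (z y b' - st (z y b')) - h m\<close>. Since \<open>m\<close> is odd,
    \<open>z = x1 m\<close> turns the trace 1 of \<open>x1 y b'\<close> into the difference
    \<open>m\<close>, and the value becomes 0.\<close>
  define m where "m = - (tvar * c1)"
  define z where "z = x1 * m"
  have stm: "st m = - m" unfolding m_def using st' by simp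
  have zm: "z * y * b' - st z * st y * st b' = m"
  proof -
    have "z * y * b' - st z * st y * st b' = m * (x1 * (y * b') + st (x1 * (y * b')))"
      unfolding z_def st_mult stm by (simp add: algebra_simps)
    thus ?thesis unfolding y by simp
  qed
  define \<beta> where "\<beta> = d * (st y * st y * st b')"
  have hk: "h = d * (y * st y)" using k y by simp
  have stb: "st b = h * st b'" unfolding b' using h(2) by simp
  have c': "c = - (d * m)" unfolding c0 k m_def by simp
  have F: "form 0 b (- st b) c p q r s = st p * s * b - st q * r * st b + st q * s * c"
    for p q r s by (simp add: form_def)
  \<comment> \<open>The pairing of \<open>(st z, y)\<close> with \<open>(r, s)\<close> is
    \<open>\<beta>\<close> times the determinant \<open>s st z - r y\<close>, so every completion to
    a basis of determinant 1 has off-diagonal entry \<open>\<beta>\<close>.\<close>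
  have v: "form 0 b (- st b) c (st z) y 1 0 = - (\<beta> * y)"
    unfolding F unfolding stb hk \<beta>_def by (simp add: algebra_simps)
  have w: "form 0 b (- st b) c (st z) y 0 1 = \<beta> * st z"
  proof -
    have "y * form 0 b (- st b) c (st z) y 0 1
        = d * (y * st y) * (z * y * b' - m)"
      unfolding F unfolding b' hk c' by (simp add: algebra_simps)
    also have "z * y * b' - m = st z * st y * st b'" using zm by (simp add: algebra_simps)
    also have "d * (y * st y) * (st z * st y * st b') = y * (\<beta> * st z)"
      unfolding \<beta>_def by (simp add: algebra_simps)
    finally show ?thesis using \<open>y \<noteq> 0\<close> by (metis mult_left_cancel)
  qed
  have vw: "form 0 b (- st b) c p q r s =
    r * form 0 b (- st b) c p q 1 0 + s * form 0 b (- st b) c p q 0 1" for p q r s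
    by (simp add: form_def algebra_simps)
  have iso: "form 0 b (- st b) c (st z) y (st z) y = 0"
    by (subst vw) (simp add: v w)
  \<comment> \<open>The ideal of \<open>st z\<close> and \<open>y\<close> contains \<open>k\<close>
    and, by \<open>zm\<close>, also \<open>m = - t c1\<close>. These are coprime: \<open>k\<close>
    is prime to \<open>c1\<close> by \<open>ij\<close> and to \<open>t\<close> since
    \<open>k(0) \<noteq> 0\<close>.\<close>
  obtain U V where UV: "U * st z + V * y = 1"
  proof -
    define C where "C = [:1 / poly k 0:]"
    have "poly (1 - C * k) 0 = 0" using k0 by (simp add: C_def)
    then obtain k2 where k2: "1 - C * k = tvar * k2" by (rule tvar_factor)
    have "1 = 1 - (1 - (i * k + j * c1)) * tvar * k2" using ij by simp
    also have "\<dots> = 1 - tvar * k2 + (i * k * tvar * k2) + (tvar * c1) * (j * k2)"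
      by (simp add: algebra_simps)
    also have "\<dots> = (C + i * tvar * k2) * k - j * k2 * m"
      unfolding k2 [symmetric] m_def by (simp add: algebra_simps)
    also have "\<dots> = (j * k2 * st y * st b') * st z + ((C + i * tvar * k2) * st y - j * k2 * z * b') * y"
      unfolding y(1) [symmetric] zm [symmetric] by (simp add: algebra_simps)
    finally show ?thesis using that by metis
  qed
  define o' where "o' = y * st y * (st (- V) * U * b' - st U * (- V) * st b') - st U * U * m"
  have ww: "form 0 b (- st b) c (- V) U (- V) U = d * o'"
    unfolding F unfolding stb b' hk c' o'_def by (simp add: std algebra_simps)
  have sto: "st o' = - o'" unfolding o'_def using stm by (simp add: algebra_simps)
  have vw1: "form 0 b (- st b) c (st z) y (- V) U = \<beta>"
  proof -
    have "form 0 b (- st b) c (st z) y (- V) U = \<beta> * (U * st z + V * y)"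
      by (subst vw) (simp add: v w algebra_simps)
    thus ?thesis unfolding UV by simp
  qed
  have swap: "form 0 b (- st b) c (- V) U (st z) y = - st \<beta>"
  proof -
    have "form 0 b (- st b) c (- V) U (st z) y = - 1 * st (form 0 b (- st b) c (st z) y (- V) U)"
      by (rule form_swap) (simp_all add: c)
    thus ?thesis unfolding vw1 by simp
  qed
  define p where "p = st y * st y * st b'"
  obtain X where X: "X * p + st (X * p) = 1"
  proof -
    \<comment> \<open>The identity \<open>A + B = 1\<close> is cubed: \<open>B * B\<close> is a
      multiple of \<open>p\<close> and \<open>A * A\<close> of \<open>st p\<close>, so the expansion
      splits into \<open>B * B * (B + 3 * A)\<close> and its conjugate.\<close>
    define A B where "A = x1 * (y * b')" and "B = st A"
    have AB: "A + B = 1" "st B = A" unfolding A_def B_def using y by simp_all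
    define W where "W = st (x1 * x1 * b' * (A + 3 * B))"
    have st3: "st 3 = (3 :: 'a poly)"
      by (metis numeral_3_eq_3 of_nat_numeral one_add_one st_1 st_add numeral_plus_one add.commute
          numeral_Bit1 numeral_One)
    have "W * p = B * B * (B + 3 * A)"
      unfolding W_def p_def st_mult st_add st3 AB(2) by (simp add: B_def A_def algebra_simps)
    moreover from this have "st (W * p) = A * A * (A + 3 * B)"
      unfolding st_mult [of W p, symmetric] by (simp add: st3 AB(2) flip: B_def)
    ultimately have "W * p + st (W * p) = (A + B) * (A + B) * (A + B)"
      by (simp add: algebra_simps)
    thus ?thesis using that AB by simp
  qed
  \<comment> \<open>Adding \<open>x'\<close> times the isotropic vector to \<open>(- V, U)\<close>
    lowers its value \<open>d o'\<close> by \<open>d o'\<close> times the trace of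
    \<open>X p\<close>, which is 1. This uses that \<open>o'\<close> is odd.\<close>
  define x' where "x' = st (- (X * o'))"
  have fin: "form 0 b (- st b) c (- V + x' * st z) (U + x' * y) (- V + x' * st z) (U + x' * y) = 0"
  proof -
    have "form 0 b (- st b) c (x' * st z + 1 * - V) (x' * y + 1 * U) (x' * st z + 1 * - V) (x' * y + 1 * U)
        = st x' * \<beta> - x' * st \<beta> + d * o'"
      unfolding form_change_basis iso vw1 swap ww by (simp add: form_def)
    also have "\<dots> = d * o' * (1 - (X * p + st (X * p)))"
      unfolding x'_def \<beta>_def p_def [symmetric] using sto std by (simp add: algebra_simps)
    finally show ?thesis unfolding X by (simp add: algebra_simps)
  qed
  have fin2: "form 0 b (- st b) c (st z) y (- V + x' * st z) (U + x' * y) = \<beta>"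
  proof -
    have "form 0 b (- st b) c (1 * st z + 0 * - V) (1 * y + 0 * U) (x' * st z + 1 * - V) (x' * y + 1 * U) = \<beta>"
      unfolding form_change_basis iso vw1 by (simp add: form_def)
    thus ?thesis by (simp add: add.commute)
  qed
  have det: "st z * (U + x' * y) - y * (- V + x' * st z) = 1" using UV by (simp add: algebra_simps)
  have bb: "b = d * (y * st y) * b'" using b' hk by simp
  have nz: "d \<noteq> 0" "y \<noteq> 0" "b' \<noteq> 0" using \<open>b \<noteq> 0\<close> unfolding bb by auto
  have "degree \<beta> = degree b" unfolding bb \<beta>_def using nz by (simp add: degree_mult_eq)
  moreover have "poly \<beta> 0 \<noteq> 0" using b0 unfolding bb \<beta>_def by simp
  ultimately show ?thesis using that [OF det iso fin] unfolding fin2 by blast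
qed

section \<open>Congruence of matrices\<close>

text \<open>\<open>e = 1\<close> is the hermitian and \<open>e = - 1\<close> the skew-hermitian
  case. One notion serves both because division by \<open>t\<close> exchanges them.\<close>

definition eherm :: "'a::comm_ring_1 poly \<Rightarrow> nat \<Rightarrow> 'a poly mat \<Rightarrow> bool" where
  "eherm e n A \<longleftrightarrow> A \<in> carrier_mat n n \<and> (\<forall>i<n. \<forall>j<n. st (A $$ (i, j)) = e * A $$ (j, i))"

definition block_reducible :: "nat \<Rightarrow> 'a::comm_ring_1 poly mat \<Rightarrow> bool" where
  "block_reducible n A \<longleftrightarrow>
    (\<exists>Bs. (\<forall>M \<in> set Bs. admissible_block M) \<and> congruent_pmat n A (diag_block_mat Bs))"

lemma star_mat_carrier [simp]: "A \<in> carrier_mat n m \<Longrightarrow> star_mat A \<in> carrier_mat m n"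
  by (simp add: star_mat_def)

lemma star_mat_index [simp]:
  "i < dim_col A \<Longrightarrow> j < dim_row A \<Longrightarrow> star_mat A $$ (i, j) = st (A $$ (j, i))"
  "dim_row (star_mat A) = dim_col A" "dim_col (star_mat A) = dim_row A"
  by (simp_all add: star_mat_def)

lemma star_mat_mult:
  assumes "A \<in> carrier_mat n m" "B \<in> carrier_mat m k"
  shows "star_mat (A * B) = star_mat B * star_mat A"
  using assms by (intro eq_matI) (auto simp: scalar_prod_def st_sum mult.commute)

lemma star_mat_one [simp]: "star_mat (1\<^sub>m n) = 1\<^sub>m n"
  by (intro eq_matI) auto

lemma star_mat_four_block:
  assumes "A \<in> carrier_mat n1 m1" "B \<in> carrier_mat n1 m2"
    "C \<in> carrier_mat n2 m1" "D \<in> carrier_mat n2 m2"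
  shows "star_mat (four_block_mat A B C D) =
    four_block_mat (star_mat A) (star_mat C) (star_mat B) (star_mat D)"
  using assms by (intro eq_matI) auto

lemma congruentI:
  assumes "S \<in> carrier_mat n n" "T \<in> carrier_mat n n" "S * T = 1\<^sub>m n" "T * S = 1\<^sub>m n"
  shows "congruent_pmat n A (star_mat S * A * S)"
proof -
  have "invertible_mat S" using assms by (auto simp: invertible_mat_def inverts_mat_def)
  with assms(1) show ?thesis unfolding congruent_pmat_def by blast
qed

lemma congruentE:
  assumes "congruent_pmat n A B"
  obtains S T where "S \<in> carrier_mat n n" "T \<in> carrier_mat n n" "S * T = 1\<^sub>m n" "T * S = 1\<^sub>m n"
    "B = star_mat S * A * S"
proof -
  obtain S where S: "S \<in> carrier_mat n n" "invertible_mat S" "B = star_mat S * A * S"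
    using assms unfolding congruent_pmat_def by blast
  obtain T where T: "S * T = 1\<^sub>m (dim_row S)" "T * S = 1\<^sub>m (dim_row T)"
    using S(2) unfolding invertible_mat_def inverts_mat_def by blast
  have "T \<in> carrier_mat n n"
    using arg_cong [OF T(1), of dim_col] arg_cong [OF T(2), of dim_col] S(1) by auto
  with S T show ?thesis using that by auto
qed

lemma congruent_carrier:
  "congruent_pmat n A B \<Longrightarrow> B \<in> carrier_mat n n"
  by (auto elim!: congruentE)

lemma congruent_refl:
  assumes "A \<in> carrier_mat n n"
  shows "congruent_pmat n A A"
  using congruentI [of "1\<^sub>m n" n "1\<^sub>m n" A] assms by simp

lemma congruent_trans:
  assumes A: "A \<in> carrier_mat n n" and "congruent_pmat n A B" "congruent_pmat n B C"
  shows "congruent_pmat n A C"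
proof -
  obtain S T where S: "S \<in> carrier_mat n n" "T \<in> carrier_mat n n" "S * T = 1\<^sub>m n" "T * S = 1\<^sub>m n"
    "B = star_mat S * A * S" using assms(2) by (rule congruentE)
  obtain U V where U: "U \<in> carrier_mat n n" "V \<in> carrier_mat n n" "U * V = 1\<^sub>m n" "V * U = 1\<^sub>m n"
    "C = star_mat U * B * U" using assms(3) by (rule congruentE)
  have inv: "(P * Q) * (Q' * P') = 1\<^sub>m n" if "P \<in> carrier_mat n n" "Q \<in> carrier_mat n n"
    "P' \<in> carrier_mat n n" "Q' \<in> carrier_mat n n" "P * P' = 1\<^sub>m n" "Q * Q' = 1\<^sub>m n"
    for P Q P' Q' :: "'a poly mat"
  proof -
    have "(P * Q) * (Q' * P') = P * (Q * (Q' * P'))"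
      using that by (intro assoc_mult_mat) auto
    also have "Q * (Q' * P') = (Q * Q') * P'"
      using that by (intro assoc_mult_mat [symmetric]) auto
    finally show ?thesis using that by simp
  qed
  have "C = star_mat (S * U) * A * (S * U)"
  proof -
    have "star_mat (S * U) = star_mat U * star_mat S" using S U by (intro star_mat_mult)
    moreover have "star_mat U * (star_mat S * A * S) * U = star_mat U * star_mat S * A * (S * U)"
    proof -
      have "star_mat U * star_mat S * A * (S * U) = star_mat U * star_mat S * A * S * U"
        using S U A by (intro assoc_mult_mat [symmetric]) auto
      also have "star_mat U * star_mat S * A * S = star_mat U * star_mat S * (A * S)"
        using S U A by (intro assoc_mult_mat) auto
      also have "\<dots> = star_mat U * (star_mat S * (A * S))"
        using S U A by (intro assoc_mult_mat) auto
      also have "star_mat S * (A * S) = star_mat S * A * S"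
        using S U A by (intro assoc_mult_mat [symmetric]) auto
      finally show ?thesis ..
    qed
    ultimately show ?thesis using S U by simp
  qed
  moreover have "congruent_pmat n A (star_mat (S * U) * A * (S * U))"
    using S U by (intro congruentI [where T = "V * T"] inv) auto
  ultimately show ?thesis by simp
qed

lemma eherm_congruent:
  assumes "eherm e n A" "congruent_pmat n A B" "st e = e" "e * e = 1"
  shows "eherm e n B"
proof -
  obtain S T where S: "S \<in> carrier_mat n n" "B = star_mat S * A * S"
    using assms(2) by (rule congruentE)
  have A: "A \<in> carrier_mat n n" "\<And>i j. i < n \<Longrightarrow> j < n \<Longrightarrow> st (A $$ (i, j)) = e * A $$ (j, i)"
    using assms(1) by (auto simp: eherm_def)
  have "star_mat A = e \<cdot>\<^sub>m A" using A by (intro eq_matI) auto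
  hence "star_mat B = star_mat S * (e \<cdot>\<^sub>m A * S)"
  proof -
    have "star_mat B = star_mat S * star_mat (star_mat S * A)"
      unfolding S(2) using S(1) A by (intro star_mat_mult) auto
    also have "star_mat (star_mat S * A) = star_mat A * star_mat (star_mat S)"
      using S(1) A by (intro star_mat_mult) auto
    also have "star_mat (star_mat S) = S" using S(1) by (intro eq_matI) auto
    finally show ?thesis using \<open>star_mat A = e \<cdot>\<^sub>m A\<close> by simp
  qed
  also have "\<dots> = e \<cdot>\<^sub>m (star_mat S * (A * S))"
  proof -
    have "e \<cdot>\<^sub>m A * S = e \<cdot>\<^sub>m (A * S)"
      using S(1) A(1) by (intro mult_smult_assoc_mat)
    moreover have "star_mat S * (e \<cdot>\<^sub>m (A * S)) = e \<cdot>\<^sub>m (star_mat S * (A * S))"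
      using S(1) A(1) by (intro mult_smult_distrib [of _ n n _ n]) auto
    ultimately show ?thesis by simp
  qed
  also have "star_mat S * (A * S) = B"
    unfolding S(2) using S(1) A(1) by (intro assoc_mult_mat [symmetric]) auto
  finally have sB: "star_mat B = e \<cdot>\<^sub>m B" .
  have B: "B \<in> carrier_mat n n" using congruent_carrier assms(2) by blast
  have "st (B $$ (i, j)) = e * B $$ (j, i)" if "i < n" "j < n" for i j
    using arg_cong [OF sB, of "\<lambda>M. M $$ (j, i)"] that B by simp
  with B show ?thesis by (simp add: eherm_def)
qed

section \<open>Base changes in a plane, permutations and block elimination\<close>

text \<open>As a base change it sends \<open>e_i\<close> to \<open>p e_i + q e_j\<close> and
  \<open>e_j\<close> to \<open>r e_i + s e_j\<close>, and fixes the other basis vectors.\<close>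

definition plane_mat :: "nat \<Rightarrow> nat \<Rightarrow> nat \<Rightarrow> 'a \<Rightarrow> 'a \<Rightarrow> 'a \<Rightarrow> 'a \<Rightarrow> 'a::comm_ring_1 mat" where
  "plane_mat n i j p q r s = mat n n (\<lambda>(k, l).
     if l = i then if k = i then p else if k = j then q else 0
     else if l = j then if k = i then r else if k = j then s else 0
     else if k = l then 1 else 0)"

lemma plane_mat_carrier [simp]: "plane_mat n i j p q r s \<in> carrier_mat n n"
  by (simp add: plane_mat_def)

lemma mult_plane_mat_index:
  assumes A: "A \<in> carrier_mat n n" and ij: "i < n" "j < n" "i \<noteq> j" "k < n" "l < n"
  shows "(A * plane_mat n i j p q r s) $$ (k, l) =
    (if l = i then A $$ (k, i) * p + A $$ (k, j) * q
     else if l = j then A $$ (k, i) * r + A $$ (k, j) * s else A $$ (k, l))"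
proof -
  have two: "(\<Sum>m\<in>{0..<n}. f m * (if m = i then x else if m = j then y else 0)) = f i * x + f j * y"
    for f :: "nat \<Rightarrow> 'a" and x y
  proof -
    have "(\<Sum>m\<in>{0..<n}. f m * (if m = i then x else if m = j then y else 0)) =
      (\<Sum>m\<in>{0..<n}. (if m = i then f m * x else 0) + (if m = j then f m * y else 0))"
      using ij by (intro sum.cong) auto
    thus ?thesis using ij by (simp add: sum.distrib)
  qed
  have "(A * plane_mat n i j p q r s) $$ (k, l) =
    (\<Sum>m\<in>{0..<n}. A $$ (k, m) * plane_mat n i j p q r s $$ (m, l))"
    using A ij by (simp add: scalar_prod_def plane_mat_def)
  also have "\<dots> = (if l = i then A $$ (k, i) * p + A $$ (k, j) * q
     else if l = j then A $$ (k, i) * r + A $$ (k, j) * s else A $$ (k, l))"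
  proof (cases "l = i \<or> l = j")
    case True
    thus ?thesis using ij two [of "\<lambda>m. A $$ (k, m)"] by (auto simp: plane_mat_def)
  next
    case False
    have "(\<Sum>m\<in>{0..<n}. A $$ (k, m) * plane_mat n i j p q r s $$ (m, l)) =
      (\<Sum>m\<in>{0..<n}. if m = l then A $$ (k, m) else 0)"
      using False ij by (intro sum.cong) (auto simp: plane_mat_def)
    thus ?thesis using False ij by simp
  qed
  finally show ?thesis .
qed

lemma plane_mat_inverse:
  assumes ij: "i < n" "j < n" "i \<noteq> j" and "p * s - q * r = 1"
  shows "plane_mat n i j p q r s * plane_mat n i j s (- q) (- r) p = 1\<^sub>m n"
proof (intro eq_matI)
  fix k l assume "k < dim_row (1\<^sub>m n :: 'a mat)" "l < dim_col (1\<^sub>m n :: 'a mat)"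
  hence kl: "k < n" "l < n" by auto
  have "(plane_mat n i j p q r s * plane_mat n i j s (- q) (- r) p) $$ (k, l) =
    (if l = i then plane_mat n i j p q r s $$ (k, i) * s + plane_mat n i j p q r s $$ (k, j) * - q
     else if l = j then plane_mat n i j p q r s $$ (k, i) * - r + plane_mat n i j p q r s $$ (k, j) * p
     else plane_mat n i j p q r s $$ (k, l))"
    using ij kl by (intro mult_plane_mat_index) auto
  also have "\<dots> = 1\<^sub>m n $$ (k, l)"
    using ij kl assms(4) by (auto simp: plane_mat_def algebra_simps)
  finally show "(plane_mat n i j p q r s * plane_mat n i j s (- q) (- r) p) $$ (k, l) =
    1\<^sub>m n $$ (k, l)" .
qed (simp_all add: plane_mat_def)

lemma congruent_plane:
  assumes A: "A \<in> carrier_mat n n" and ij: "i < n" "j < n" "i \<noteq> j" and det: "p * s - q * r = 1"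
  obtains B where "congruent_pmat n A B"
    "B $$ (i, i) = form (A $$ (i, i)) (A $$ (i, j)) (A $$ (j, i)) (A $$ (j, j)) p q p q"
    "B $$ (i, j) = form (A $$ (i, i)) (A $$ (i, j)) (A $$ (j, i)) (A $$ (j, j)) p q r s"
    "B $$ (j, j) = form (A $$ (i, i)) (A $$ (i, j)) (A $$ (j, i)) (A $$ (j, j)) r s r s"
    "\<And>k. k < n \<Longrightarrow> k \<noteq> i \<Longrightarrow> k \<noteq> j \<Longrightarrow> B $$ (k, i) = A $$ (k, i) * p + A $$ (k, j) * q"
    "\<And>k. k < n \<Longrightarrow> k \<noteq> i \<Longrightarrow> k \<noteq> j \<Longrightarrow> B $$ (k, k) = A $$ (k, k)"
proof -
  let ?S = "plane_mat n i j p q r s" and ?T = "plane_mat n i j s (- q) (- r) p"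
  define B where "B = star_mat ?S * A * ?S"
  have "?T * plane_mat n i j p (- (- q)) (- (- r)) s = 1\<^sub>m n"
    using det by (intro plane_mat_inverse ij) (simp add: algebra_simps)
  hence TS: "?T * ?S = 1\<^sub>m n" by simp
  have cong: "congruent_pmat n A B"
    unfolding B_def by (rule congruentI [OF _ _ plane_mat_inverse TS]) (use ij det in auto)
  have SA: "star_mat ?S * A \<in> carrier_mat n n" 
    by (rule mult_carrier_mat [OF star_mat_carrier [OF plane_mat_carrier] A])
  have SA_idx: "(star_mat ?S * A) $$ (k, l) =
    (if k = i then st p * A $$ (i, l) + st q * A $$ (j, l)
     else if k = j then st r * A $$ (i, l) + st s * A $$ (j, l) else A $$ (k, l))"
    if kl: "k < n" "l < n" for k l
  proof -
    \<comment> \<open>The row operation is obtained by applying \<open>star_mat\<close> to a column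
      operation.\<close>
    have "star_mat (star_mat A * ?S) = star_mat ?S * star_mat (star_mat A)"
      using A by (intro star_mat_mult [of _ n n _ n]) auto
    also have "star_mat (star_mat A) = A" using A by (intro eq_matI) auto
    finally have "(star_mat ?S * A) $$ (k, l) = star_mat (star_mat A * ?S) $$ (k, l)" by simp
    also have "\<dots> = st ((star_mat A * ?S) $$ (l, k))" using A kl by (simp add: plane_mat_def)
    also have "(star_mat A * ?S) $$ (l, k) = (if k = i then star_mat A $$ (l, i) * p + star_mat A $$ (l, j) * q
     else if k = j then star_mat A $$ (l, i) * r + star_mat A $$ (l, j) * s else star_mat A $$ (l, k))"
      using A ij kl by (intro mult_plane_mat_index) auto
    finally show ?thesis using A ij kl by (auto simp: mult.commute)
  qed
  note idx = mult_plane_mat_index [OF SA ij, where p = p and q = q and r = r and s = s, folded B_def]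
  show ?thesis
    by (rule that [OF cong]) (use ij in \<open>simp_all add: idx SA_idx form_def algebra_simps\<close>)
qed

lemma congruent_permute:
  assumes A: "A \<in> carrier_mat n n" and f: "bij_betw f {0..<n} {0..<n}"
  shows "congruent_pmat n A (mat n n (\<lambda>(k, l). A $$ (f k, f l)))"
proof -
  have lt: "f k < n" if "k < n" for k using bij_betwE [OF f] that by auto
  have inj: "f k = f l \<longleftrightarrow> k = l" if "k < n" "l < n" for k l
    using bij_betw_imp_inj_on [OF f] that by (auto dest: inj_onD)
  define S :: "'a poly mat" where "S = mat n n (\<lambda>(k, l). if k = f l then 1 else 0)"
  have S: "S \<in> carrier_mat n n" by (simp add: S_def)
  have mS: "(M * S) $$ (k, l) = M $$ (k, f l)" if "M \<in> carrier_mat n n" "k < n" "l < n" for M k l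
  proof -
    have "(M * S) $$ (k, l) = (\<Sum>m\<in>{0..<n}. M $$ (k, m) * (if m = f l then 1 else 0))"
      using that by (simp add: scalar_prod_def S_def)
    also have "\<dots> = (\<Sum>m\<in>{0..<n}. if m = f l then M $$ (k, m) else 0)"
      by (intro sum.cong) auto
    finally have "(M * S) $$ (k, l) = (\<Sum>m\<in>{0..<n}. if m = f l then M $$ (k, m) else 0)" .
    thus ?thesis using that lt by simp
  qed
  have starS: "(star_mat S * M) $$ (k, l) = M $$ (f k, l)"
    if "M \<in> carrier_mat n n" "k < n" "l < n" for M k l
  proof -
    have "(star_mat S * M) $$ (k, l) = (\<Sum>m\<in>{0..<n}. st (if m = f k then 1 else 0) * M $$ (m, l))"
      using that by (simp add: scalar_prod_def S_def)
    also have "\<dots> = (\<Sum>m\<in>{0..<n}. if m = f k then M $$ (m, l) else 0)"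
      by (intro sum.cong) auto
    finally have "(star_mat S * M) $$ (k, l) = (\<Sum>m\<in>{0..<n}. if m = f k then M $$ (m, l) else 0)" .
    thus ?thesis using that lt by simp
  qed
  have one: "star_mat S * S = 1\<^sub>m n"
  proof (intro eq_matI)
    fix k l assume "k < dim_row (1\<^sub>m n :: 'a poly mat)" "l < dim_col (1\<^sub>m n :: 'a poly mat)"
    hence kl: "k < n" "l < n" by auto
    have "(star_mat S * S) $$ (k, l) = S $$ (f k, l)" using starS [OF S kl] .
    also have "\<dots> = 1\<^sub>m n $$ (k, l)" using kl lt inj by (simp add: S_def)
    finally show "(star_mat S * S) $$ (k, l) = 1\<^sub>m n $$ (k, l)" .
  qed (use S in auto)
  have surj: "\<exists>m<n. f m = k" if "k < n" for k
    using bij_betw_imp_surj_on [OF f] that by (metis atLeast0LessThan imageE lessThan_iff)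
  have "S * star_mat S = 1\<^sub>m n"
  proof (intro eq_matI)
    fix k l assume "k < dim_row (1\<^sub>m n :: 'a poly mat)" "l < dim_col (1\<^sub>m n :: 'a poly mat)"
    hence kl: "k < n" "l < n" by auto
    obtain m m' where m: "m < n" "f m = k" "m' < n" "f m' = l" using surj kl by metis
    have "(S * star_mat S) $$ (k, l) = (\<Sum>a\<in>{0..<n}. S $$ (k, a) * st (S $$ (l, a)))"
      using S kl by (simp add: scalar_prod_def)
    also have "\<dots> = (\<Sum>a\<in>{0..<n}. if a = m then if m = m' then 1 else 0 else 0)"
      using m inj kl by (intro sum.cong) (auto simp: S_def)
    also have "\<dots> = 1\<^sub>m n $$ (k, l)" using m inj kl by auto
    finally show "(S * star_mat S) $$ (k, l) = 1\<^sub>m n $$ (k, l)" .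
  qed (use S in auto)
  with one S have "congruent_pmat n A (star_mat S * A * S)" by (intro congruentI) auto
  moreover have "star_mat S * A \<in> carrier_mat n n" by (rule mult_carrier_mat [OF star_mat_carrier [OF S] A])
  hence "star_mat S * A * S = mat n n (\<lambda>(k, l). A $$ (f k, f l))"
    using S lt by (intro eq_matI) (simp_all add: mS starS [OF A] del: index_mult_mat(1))
  ultimately show ?thesis by simp
qed

lemma congruent_four_block:
  assumes M: "M \<in> carrier_mat m1 m1" and D: "D \<in> carrier_mat m2 m2" and DE: "congruent_pmat m2 D E"
  shows "congruent_pmat (m1 + m2) (four_block_mat M (0\<^sub>m m1 m2) (0\<^sub>m m2 m1) D)
    (four_block_mat M (0\<^sub>m m1 m2) (0\<^sub>m m2 m1) E)"
proof -
  obtain S T where S: "S \<in> carrier_mat m2 m2" "T \<in> carrier_mat m2 m2" "S * T = 1\<^sub>m m2" "T * S = 1\<^sub>m m2"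
    "E = star_mat S * D * S" using DE by (rule congruentE)
  let ?F = "\<lambda>P Q. four_block_mat P (0\<^sub>m m1 m2) (0\<^sub>m m2 m1) Q"
  have mult: "?F P Q * ?F P' Q' = ?F (P * P') (Q * Q')"
    if "P \<in> carrier_mat m1 m1" "P' \<in> carrier_mat m1 m1" "Q \<in> carrier_mat m2 m2" "Q' \<in> carrier_mat m2 m2"
    for P P' Q Q' :: "'a poly mat"
    using that by (subst mult_four_block_mat) auto
  have star: "star_mat (?F (1\<^sub>m m1) S) = ?F (1\<^sub>m m1) (star_mat S)"
    using S by (subst star_mat_four_block) (auto intro!: arg_cong2 [of _ _ _ _ "\<lambda>x y. four_block_mat _ x y _"] eq_matI)
  have "congruent_pmat (m1 + m2) (?F M D) (star_mat (?F (1\<^sub>m m1) S) * ?F M D * ?F (1\<^sub>m m1) S)"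
    using S by (intro congruentI [where T = "?F (1\<^sub>m m1) T"]) (simp_all add: mult)
  also have "star_mat (?F (1\<^sub>m m1) S) * ?F M D * ?F (1\<^sub>m m1) S = ?F M E"
    unfolding star S(5) using S M D by (simp add: mult mult_carrier_mat [of _ m2 m2])
  finally show ?thesis .
qed

text \<open>Block elimination: \<open>x\<close> solves \<open>A1 X = - A2\<close>, so the unipotent
  base change with block \<open>X\<close> clears the upper right block without inverting
  \<open>A1\<close>, and symmetry then clears the lower left one.\<close>

lemma split_off_block:
  assumes A: "eherm e (m1 + m2) A" and e: "st e = e" "e * e = 1"
    and x: "\<And>i j. i < m1 \<Longrightarrow> j < m2 \<Longrightarrow> (\<Sum>k\<in>{0..<m1}. A $$ (i, k) * x k j) = - A $$ (i, m1 + j)"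
    and M: "admissible_block (mat m1 m1 (($$) A))"
    and IH: "\<And>D. eherm e m2 D \<Longrightarrow> block_reducible m2 D"
  shows "block_reducible (m1 + m2) A"
proof -
  let ?n = "m1 + m2"
  have Ac: "A \<in> carrier_mat ?n ?n" using A by (simp add: eherm_def)
  obtain A1 A2 A3 A4 where sb: "split_block A m1 m1 = (A1, A2, A3, A4)" by (metis prod_cases4)
  have blk: "A1 \<in> carrier_mat m1 m1" "A2 \<in> carrier_mat m1 m2" "A3 \<in> carrier_mat m2 m1"
    "A4 \<in> carrier_mat m2 m2" "A = four_block_mat A1 A2 A3 A4"
    using split_block [OF sb, of m2 m2] Ac by auto
  have A1: "A1 = mat m1 m1 (($$) A)" and A2: "A2 = mat m1 m2 (\<lambda>(i, j). A $$ (i, j + m1))"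
    using sb Ac unfolding split_block_def Let_def by auto
  define X where "X = mat m1 m2 (\<lambda>(k, j). x k j)"
  have X: "X \<in> carrier_mat m1 m2" by (simp add: X_def)
  have AX: "A1 * X + A2 = 0\<^sub>m m1 m2"
    using x by (intro eq_matI) (auto simp: A1 A2 X_def scalar_prod_def add.commute)
  let ?O = "0\<^sub>m m2 m1 :: 'a poly mat" and ?O' = "0\<^sub>m m1 m2 :: 'a poly mat"
  let ?S = "\<lambda>X. four_block_mat (1\<^sub>m m1) X ?O (1\<^sub>m m2)"
  have inv: "?S Y * ?S Z = 1\<^sub>m ?n" if "Y \<in> carrier_mat m1 m2" "Z \<in> carrier_mat m1 m2" "Z + Y = 0\<^sub>m m1 m2"
    for Y Z :: "'a poly mat"
    using that by (subst mult_four_block_mat) auto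
  have S: "?S X \<in> carrier_mat ?n ?n" by auto
  have cong: "congruent_pmat ?n A (star_mat (?S X) * A * ?S X)"
    using X by (intro congruentI [where T = "?S (- X)"] inv) auto
  have AS: "A * ?S X = four_block_mat A1 ?O' A3 (A3 * X + A4)"
  proof -
    have "A * ?S X = four_block_mat (A1 * 1\<^sub>m m1 + A2 * ?O) (A1 * X + A2 * 1\<^sub>m m2)
      (A3 * 1\<^sub>m m1 + A4 * ?O) (A3 * X + A4 * 1\<^sub>m m2)"
      unfolding blk(5) using blk X by (intro mult_four_block_mat) auto
    thus ?thesis using blk X AX by simp
  qed
  define C where "C = star_mat X * A1 + A3"
  define D where "D = A3 * X + A4"
  have CD: "C \<in> carrier_mat m2 m1" "D \<in> carrier_mat m2 m2" unfolding C_def D_def using blk X by auto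
  define B where "B = star_mat (?S X) * A * ?S X"
  have "B = star_mat (?S X) * (A * ?S X)"
    unfolding B_def using Ac S by (intro assoc_mult_mat) auto
  also have "star_mat (?S X) = four_block_mat (star_mat (1\<^sub>m m1)) (star_mat ?O) (star_mat X) (star_mat (1\<^sub>m m2))"
    using X by (intro star_mat_four_block) auto
  also have "star_mat ?O = ?O'" by (intro eq_matI) auto
  also have "four_block_mat (star_mat (1\<^sub>m m1)) ?O' (star_mat X) (star_mat (1\<^sub>m m2)) * (A * ?S X) =
    four_block_mat (1\<^sub>m m1 * A1 + ?O' * A3) (1\<^sub>m m1 * ?O' + ?O' * D)
      (star_mat X * A1 + 1\<^sub>m m2 * A3) (star_mat X * ?O' + 1\<^sub>m m2 * D)"
    unfolding AS D_def [symmetric] star_mat_one using blk X CD by (intro mult_four_block_mat) auto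
  also have "\<dots> = four_block_mat A1 ?O' C D"
    using blk X CD by (simp add: C_def right_mult_zero_mat [of _ m2 m1])
  finally have B: "B = four_block_mat A1 ?O' C D" .
  have Bh: "eherm e ?n B" using eherm_congruent A cong e B_def by metis
  have C0: "C = ?O"
  proof (intro eq_matI)
    fix i j assume "i < dim_row ?O" "j < dim_col ?O"
    hence ij: "i < m2" "j < m1" by auto
    hence "st (B $$ (j, m1 + i)) = e * B $$ (m1 + i, j)" using Bh by (simp add: eherm_def)
    hence "e * C $$ (i, j) = 0" using ij blk CD unfolding B by simp
    hence "e * e * C $$ (i, j) = 0" by (simp add: mult.assoc)
    thus "C $$ (i, j) = ?O $$ (i, j)" using e ij by simp
  qed (use CD in auto)
  have "eherm e m2 D" unfolding eherm_def
  proof (intro conjI allI impI)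
    fix i j assume ij: "i < m2" "j < m2"
    hence "st (B $$ (m1 + i, m1 + j)) = e * B $$ (m1 + j, m1 + i)" using Bh by (simp add: eherm_def)
    thus "st (D $$ (i, j)) = e * D $$ (j, i)" using ij blk CD unfolding B by simp
  qed (rule CD)
  from IH [OF this] obtain Bs where Bs: "\<forall>M\<in>set Bs. admissible_block M"
    "congruent_pmat m2 D (diag_block_mat Bs)" unfolding block_reducible_def by blast
  have "congruent_pmat ?n B (four_block_mat A1 ?O' ?O (diag_block_mat Bs))"
    unfolding B C0 using blk CD Bs by (intro congruent_four_block) auto
  moreover have "four_block_mat A1 ?O' ?O (diag_block_mat Bs) = diag_block_mat (A1 # Bs)"
    using congruent_carrier [OF Bs(2)] blk(1) by (simp add: Let_def)
  ultimately have "congruent_pmat ?n A (diag_block_mat (A1 # Bs))"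
    using congruent_trans [OF Ac cong] B_def by metis
  thus ?thesis unfolding block_reducible_def using Bs(1) M A1
    by (intro exI [of _ "A1 # Bs"]) auto
qed

section \<open>Splitting off blocks\<close>

lemma dvd_same_degree:
  fixes g a :: "'a::field poly"
  assumes "g dvd a" "degree a \<le> degree g" "a \<noteq> 0"
  shows "a dvd g"
proof -
  obtain k where k: "a = g * k" using assms(1) by blast
  with assms have "g \<noteq> 0" "k \<noteq> 0" "degree k = 0" by (auto simp: degree_mult_eq)
  hence "is_unit k" by (metis is_unit_iff_degree)
  thus ?thesis unfolding k by (simp add: mult_unit_dvd_iff)
qed

lemma block_reducible_congruent:
  assumes "A \<in> carrier_mat n n" "congruent_pmat n A B" "block_reducible n B"
  shows "block_reducible n A"
  using assms congruent_trans unfolding block_reducible_def by blast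

lemma bij_transpose:
  fixes n :: nat
  assumes "i < n" "j < n"
  shows "bij_betw (transpose i j) {0..<n} {0..<n}"
  by (rule bij_betw_byWitness [where f' = "transpose i j"])
    (use assms in \<open>auto simp: transpose_def\<close>)

lemma split_off_entry:
  assumes A: "eherm e (Suc m) A" and e: "st e = e" "e * e = 1" and i: "i < Suc m"
    and dvd: "\<And>k. k < Suc m \<Longrightarrow> k \<noteq> i \<Longrightarrow> A $$ (i, i) dvd A $$ (i, k)"
    and IH: "\<And>D. eherm e m D \<Longrightarrow> block_reducible m D"
  shows "block_reducible (Suc m) A"
proof -
  have Ac: "A \<in> carrier_mat (Suc m) (Suc m)" using A by (simp add: eherm_def)
  define f where "f = transpose 0 i"
  have f: "bij_betw f {0..<Suc m} {0..<Suc m}" unfolding f_def using i by (intro bij_transpose) auto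
  have f0: "f 0 = i" by (simp add: f_def)
  define B where "B = mat (Suc m) (Suc m) (\<lambda>(k, l). A $$ (f k, f l))"
  have cong: "congruent_pmat (Suc m) A B" unfolding B_def by (rule congruent_permute [OF Ac f])
  hence Bh: "eherm e (1 + m) B" using eherm_congruent A e by simp
  have "\<exists>x. A $$ (i, f (Suc j)) = A $$ (i, i) * x" if "j < m" for j
  proof -
    have "f (Suc j) \<noteq> f 0" using bij_betw_imp_inj_on [OF f] that by (auto dest: inj_onD)
    moreover have "f (Suc j) < Suc m" using bij_betwE [OF f] that by auto
    ultimately show ?thesis using dvd [of "f (Suc j)"] f0 by (auto elim: dvdE)
  qed
  then obtain x where x: "\<And>j. j < m \<Longrightarrow> A $$ (i, f (Suc j)) = A $$ (i, i) * x j" by metis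
  have "block_reducible (1 + m) B"
    by (rule split_off_block [OF Bh e, where x = "\<lambda>_ j. - x j"])
      (use x f0 IH in \<open>auto simp: B_def admissible_block_def\<close>)
  thus ?thesis using block_reducible_congruent Ac cong by simp
qed

lemma split_off_hyperbolic:
  assumes A: "eherm e (2 + m) A" and e: "st e = e" "e * e = 1"
    and ij: "i < 2 + m" "j < 2 + m" "i \<noteq> j" "A $$ (i, i) = 0" "A $$ (j, j) = 0"
    and dvd: "\<And>k. k < 2 + m \<Longrightarrow> k \<noteq> i \<Longrightarrow> k \<noteq> j \<Longrightarrow> A $$ (i, j) dvd A $$ (i, k)"
      "\<And>k. k < 2 + m \<Longrightarrow> k \<noteq> i \<Longrightarrow> k \<noteq> j \<Longrightarrow> A $$ (j, i) dvd A $$ (j, k)"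
    and IH: "\<And>D. eherm e m D \<Longrightarrow> block_reducible m D"
  shows "block_reducible (2 + m) A"
proof -
  let ?n = "2 + m"
  have Ac: "A \<in> carrier_mat ?n ?n" using A by (simp add: eherm_def)
  \<comment> \<open>The inner transposition takes 1 to the index that the outer one sends to
    \<open>j\<close>; it fixes 0, which the outer one sends to \<open>i\<close>.\<close>
  define f where "f = transpose 0 i \<circ> transpose 1 (transpose 0 i j)"
  have lt: "transpose 0 i j < ?n" using ij by (auto simp: transpose_def)
  have f: "bij_betw f {0..<?n} {0..<?n}"
    unfolding f_def using ij lt by (intro bij_betw_trans [OF bij_transpose bij_transpose]) auto
  have f0: "f 0 = i" and f1: "f (Suc 0) = j" using ij(3) by (auto simp: f_def transpose_def)
  define B where "B = mat ?n ?n (\<lambda>(k, l). A $$ (f k, f l))"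
  have cong: "congruent_pmat ?n A B" unfolding B_def by (rule congruent_permute [OF Ac f])
  hence Bh: "eherm e ?n B" using eherm_congruent A e by blast
  have fk: "f (Suc (Suc k)) \<noteq> i" "f (Suc (Suc k)) \<noteq> j" "f (Suc (Suc k)) < ?n" if "k < m" for k
  proof -
    have "f (Suc (Suc k)) \<noteq> f 0" "f (Suc (Suc k)) \<noteq> f (Suc 0)"
      using bij_betw_imp_inj_on [OF f] that by (auto dest: inj_onD)
    thus "f (Suc (Suc k)) \<noteq> i" "f (Suc (Suc k)) \<noteq> j" using f0 f1 by auto
    show "f (Suc (Suc k)) < ?n" using bij_betwE [OF f] that by auto
  qed
  have "\<exists>x. A $$ (i, f (Suc (Suc k))) = A $$ (i, j) * x" if "k < m" for k
    using dvd(1) [OF fk(3) fk(1,2)] that by blast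
  then obtain x where x: "\<And>k. k < m \<Longrightarrow> A $$ (i, f (Suc (Suc k))) = A $$ (i, j) * x k" by metis
  have "\<exists>y. A $$ (j, f (Suc (Suc k))) = A $$ (j, i) * y" if "k < m" for k
    using dvd(2) [OF fk(3) fk(1,2)] that by blast
  then obtain y where y: "\<And>k. k < m \<Longrightarrow> A $$ (j, f (Suc (Suc k))) = A $$ (j, i) * y k" by metis
  have "block_reducible ?n B"
  \<comment> \<open>The block has zero diagonal, so its first row meets only the second row of the
    solution and conversely; hence \<open>y\<close> stands in row 0 and \<open>x\<close> in row
    1.\<close>
  proof (rule split_off_block [OF Bh e, where x = "\<lambda>k l. if k = 0 then - y l else - x l"])
    fix k l :: nat assume "k < 2" "l < m"
    moreover from this have "k = 0 \<or> k = 1" by auto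
    ultimately show "(\<Sum>a\<in>{0..<2}. B $$ (k, a) * (if a = 0 then - y l else - x l)) = - B $$ (k, 2 + l)"
      using x y f0 f1 ij by (auto simp: B_def numeral_2_eq_2)
  qed (use f0 f1 ij IH in \<open>auto simp: B_def admissible_block_def\<close>)
  thus ?thesis using block_reducible_congruent Ac cong by blast
qed

section \<open>Descent to an entry of least degree\<close>

lemma hermitian_step:
  fixes A :: "'a::alg_closed_field poly mat"
  assumes two: "(2::'a) \<noteq> 0" and A: "eherm 1 (Suc m) A"
    and kl: "k < Suc m" "l < Suc m" "poly (A $$ (k, l)) 0 \<noteq> 0"
    and IH: "\<And>D :: 'a poly mat. eherm 1 m D \<Longrightarrow> block_reducible m D"
  shows "block_reducible (Suc m) A"
proof -
  let ?n = "Suc m"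
  define P where "P = (\<lambda>(B, i). congruent_pmat ?n A B \<and> i < ?n \<and> poly (B $$ (i, i)) 0 \<noteq> 0)"
  have Ac: "A \<in> carrier_mat ?n ?n" using A by (simp add: eherm_def)
  have herm: "eherm 1 ?n B" if "congruent_pmat ?n A B" for B
    using eherm_congruent [OF A that] by simp
  have "\<exists>z. P z"
  proof (cases "\<exists>i<?n. poly (A $$ (i, i)) 0 \<noteq> 0")
    case True
    thus ?thesis unfolding P_def using congruent_refl [OF Ac] by blast
  next
    case False
    hence ne: "k \<noteq> l" using kl by auto
    \<comment> \<open>The vector \<open>e_k + e_l\<close> has value \<open>2 A_kl(0)\<close> at
      \<open>t = 0\<close>, where all diagonal entries vanish.\<close>
    obtain B where B: "congruent_pmat ?n A B"
      "B $$ (k, k) = form (A $$ (k, k)) (A $$ (k, l)) (A $$ (l, k)) (A $$ (l, l)) 1 1 1 1"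
      by (rule congruent_plane [OF Ac kl(1,2) ne, of 1 1 1 0]) auto
    have "A $$ (l, k) = st (A $$ (k, l))" using A kl by (simp add: eherm_def)
    hence "poly (B $$ (k, k)) 0 = 2 * poly (A $$ (k, l)) 0"
      using False kl unfolding B(2) by (simp add: form_def)
    hence "poly (B $$ (k, k)) 0 \<noteq> 0" using two kl by simp
    with B(1) kl(1) show ?thesis unfolding P_def by blast
  qed
  then obtain z where z: "P z" "\<And>w. P w \<Longrightarrow> degree (fst z $$ (snd z, snd z)) \<le> degree (fst w $$ (snd w, snd w))"
    using ex_has_least_nat [of P _ "\<lambda>z. degree (fst z $$ (snd z, snd z))"] by blast
  obtain B i where Bi: "z = (B, i)" by force
  have cong: "congruent_pmat ?n A B" and i: "i < ?n" and B0: "poly (B $$ (i, i)) 0 \<noteq> 0"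
    using z(1) unfolding P_def Bi by auto
  have Bc: "B \<in> carrier_mat ?n ?n" using cong by (rule congruent_carrier)
  have Bh: "\<And>a b. a < ?n \<Longrightarrow> b < ?n \<Longrightarrow> st (B $$ (a, b)) = B $$ (b, a)"
    using herm [OF cong] by (simp add: eherm_def)
  have "B $$ (i, i) dvd B $$ (i, k)" if k: "k < ?n" "k \<noteq> i" for k
  proof -
    obtain p q r s where pq: "p * s - q * r = 1"
      and g: "poly (form (B $$ (i, i)) (B $$ (i, k)) (B $$ (k, i)) (B $$ (k, k)) p q p q) 0 \<noteq> 0"
      "form (B $$ (i, i)) (B $$ (i, k)) (B $$ (k, i)) (B $$ (k, k)) p q p q dvd B $$ (i, i)"
      "form (B $$ (i, i)) (B $$ (i, k)) (B $$ (k, i)) (B $$ (k, k)) p q p q dvd B $$ (i, k)"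
      by (rule hermitian_binary_value [OF two, of "B $$ (i, i)" "B $$ (k, k)" "B $$ (k, i)" "B $$ (i, k)"])
        (use Bh i k B0 in auto)
    obtain C where C: "congruent_pmat ?n B C"
      "C $$ (i, i) = form (B $$ (i, i)) (B $$ (i, k)) (B $$ (k, i)) (B $$ (k, k)) p q p q"
      using congruent_plane [OF Bc i k(1) k(2) [symmetric] pq] by blast
    have "P (C, i)" unfolding P_def using congruent_trans [OF Ac cong C(1)] i g(1) C(2) by simp
    from z(2) [OF this] have "degree (B $$ (i, i)) \<le> degree (C $$ (i, i))" by (simp add: Bi)
    moreover have "B $$ (i, i) \<noteq> 0" using B0 by (metis poly_0)
    \<comment> \<open>A divisor of the minimal entry that is itself a candidate must be associated
      to it.\<close>
    ultimately have "B $$ (i, i) dvd C $$ (i, i)"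
      using g(2) dvd_same_degree unfolding C(2) [symmetric] by blast
    thus ?thesis using g(3) unfolding C(2) [symmetric] by (rule dvd_trans)
  qed
  with herm [OF cong] i IH have "block_reducible ?n B" by (intro split_off_entry [of 1]) auto
  thus ?thesis using block_reducible_congruent Ac cong by blast
qed

lemma skew_step:
  fixes A :: "'a::alg_closed_field poly mat"
  assumes two: "(2::'a) \<noteq> 0" and A: "eherm (- 1) n A"
    and kl: "k < n" "l < n" "poly (A $$ (k, l)) 0 \<noteq> 0"
    and IH: "\<And>m (D :: 'a poly mat). m < n \<Longrightarrow> eherm (- 1) m D \<Longrightarrow> block_reducible m D"
  shows "block_reducible n A"
proof -
  define P where "P = (\<lambda>(B, i, j). congruent_pmat n A B \<and> i < n \<and> j < n \<and> i \<noteq> j \<and>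
    B $$ (i, i) = 0 \<and> poly (B $$ (i, j)) 0 \<noteq> 0)"
  define deg where "deg = (\<lambda>(B :: 'a poly mat, i, j). degree (B $$ (i, j)))"
  have Ac: "A \<in> carrier_mat n n" using A by (simp add: eherm_def)
  have herm: "st (B $$ (a, b)) = - B $$ (b, a)" if "congruent_pmat n A B" "a < n" "b < n" for B a b
    using eherm_congruent [OF A that(1)] that by (simp add: eherm_def)
  have "\<exists>z. P z"
  proof -
    note h = herm [OF congruent_refl [OF Ac]]
    have ne: "k \<noteq> l" using odd_poly_zero [OF two h [OF kl(1,1)]] kl(3) by blast
    have lk: "A $$ (l, k) = - st (A $$ (k, l))" unfolding h [OF kl(1,2)] by simp
    obtain p q r s where pq: "p * s - q * r = 1"
      "form (A $$ (k, k)) (A $$ (k, l)) (A $$ (l, k)) (A $$ (l, l)) p q p q = 0"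
      "poly (form (A $$ (k, k)) (A $$ (k, l)) (A $$ (l, k)) (A $$ (l, l)) p q r s) 0 \<noteq> 0"
      by (rule skew_isotropic_basis [OF two h [OF kl(1,1)] h [OF kl(2,2)] lk kl(3)])
    obtain B where B: "congruent_pmat n A B"
      "B $$ (k, k) = form (A $$ (k, k)) (A $$ (k, l)) (A $$ (l, k)) (A $$ (l, l)) p q p q"
      "B $$ (k, l) = form (A $$ (k, k)) (A $$ (k, l)) (A $$ (l, k)) (A $$ (l, l)) p q r s"
      by (rule congruent_plane [OF Ac kl(1,2) ne pq(1)])
    have "P (B, k, l)" unfolding P_def using B pq(2,3) kl ne by simp
    thus ?thesis ..
  qed
  then obtain z where z: "P z" "\<And>w. P w \<Longrightarrow> deg z \<le> deg w"
    using ex_has_least_nat [of P _ deg] by blast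
  \<comment> \<open>A base change in the plane \<open>j, k\<close> leaves \<open>B_ii = 0\<close>
    untouched and replaces \<open>B_ij\<close> by the gcd \<open>d\<close> of \<open>B_ij\<close>
    and \<open>B_ik\<close>. Still \<open>d(0) \<noteq> 0\<close>, so minimality makes
    \<open>d\<close> associated to \<open>B_ij\<close>.\<close>
  have dvd: "B $$ (i, j) dvd B $$ (i, k)"
    if B: "P (B, i, j)" "deg (B, i, j) \<le> deg z" and k: "k < n" "k \<noteq> i" "k \<noteq> j" for B i j k
  proof -
    have Pd: "congruent_pmat n A B" "i < n" "j < n" "i \<noteq> j" "B $$ (i, i) = 0" "poly (B $$ (i, j)) 0 \<noteq> 0"
      using B(1) unfolding P_def by auto
    have nz: "B $$ (i, j) \<noteq> 0" using Pd(6) by (metis poly_0)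
    hence "\<not> (B $$ (i, j) = 0 \<and> B $$ (i, k) = 0)" by blast
    then obtain d f g x y where "d \<noteq> 0"
      and d: "B $$ (i, j) = d * f" "B $$ (i, k) = d * g" "x * f + y * g = 1"
      by (rule coprime_part)
    have det: "x * f - y * (- g) = 1" using d(3) by simp
    obtain C where C: "congruent_pmat n B C" "C $$ (i, i) = B $$ (i, i)" "C $$ (i, j) = d"
    proof (rule congruent_plane [OF congruent_carrier [OF Pd(1)] Pd(3) k(1) k(3) [symmetric] det])
      fix C
      assume C: "congruent_pmat n B C"
        "\<And>a. a < n \<Longrightarrow> a \<noteq> j \<Longrightarrow> a \<noteq> k \<Longrightarrow> C $$ (a, j) = B $$ (a, j) * x + B $$ (a, k) * y"
        "\<And>a. a < n \<Longrightarrow> a \<noteq> j \<Longrightarrow> a \<noteq> k \<Longrightarrow> C $$ (a, a) = B $$ (a, a)"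
      have "C $$ (i, j) = d * (x * f + y * g)"
        unfolding C(2) [OF Pd(2,4) k(2) [symmetric]] d(1,2) by (simp add: algebra_simps)
      also have "\<dots> = d" unfolding d(3) by simp
      finally show thesis by (rule that [OF C(1) C(3) [OF Pd(2,4) k(2) [symmetric]]])
    qed
    have "P (C, i, j)" unfolding P_def
      using congruent_trans [OF Ac Pd(1) C(1)] Pd C(2,3) d(1) by auto
    from z(2) [OF this] B(2) have "degree (B $$ (i, j)) \<le> degree d" by (simp add: deg_def C(3))
    hence "B $$ (i, j) dvd d" using d(1) nz by (metis dvd_same_degree dvd_triv_left)
    thus ?thesis unfolding d(2) by (rule dvd_mult2)
  qed
  obtain B i j where Bi: "z = (B, i, j)" by (metis prod_cases3)
  have Pd: "congruent_pmat n A B" "i < n" "j < n" "i \<noteq> j" "B $$ (i, i) = 0" "poly (B $$ (i, j)) 0 \<noteq> 0"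
    using z(1) unfolding P_def Bi by auto
  note Bh = herm [OF Pd(1)]
  have ji: "B $$ (j, i) = - st (B $$ (i, j))" unfolding Bh [OF Pd(2,3)] by simp
  obtain p q r s where pq: "p * s - q * r = 1"
    "form 0 (B $$ (i, j)) (B $$ (j, i)) (B $$ (j, j)) p q p q = 0"
    "form 0 (B $$ (i, j)) (B $$ (j, i)) (B $$ (j, j)) r s r s = 0"
    "poly (form 0 (B $$ (i, j)) (B $$ (j, i)) (B $$ (j, j)) p q r s) 0 \<noteq> 0"
    "degree (form 0 (B $$ (i, j)) (B $$ (j, i)) (B $$ (j, j)) p q r s) = degree (B $$ (i, j))"
    by (rule skew_hyperbolic_basis [OF two Bh [OF Pd(3,3)] Pd(6), folded ji])
  obtain C where C: "congruent_pmat n B C"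
    "C $$ (i, i) = form (B $$ (i, i)) (B $$ (i, j)) (B $$ (j, i)) (B $$ (j, j)) p q p q"
    "C $$ (i, j) = form (B $$ (i, i)) (B $$ (i, j)) (B $$ (j, i)) (B $$ (j, j)) p q r s"
    "C $$ (j, j) = form (B $$ (i, i)) (B $$ (i, j)) (B $$ (j, i)) (B $$ (j, j)) r s r s"
    by (rule congruent_plane [OF congruent_carrier [OF Pd(1)] Pd(2-4) pq(1)])
  note C = C [unfolded Pd(5) pq(2,3)]
  have cong: "congruent_pmat n A C" using congruent_trans [OF Ac Pd(1) C(1)] .
  have Cji: "C $$ (j, i) = - st (C $$ (i, j))" unfolding herm [OF cong Pd(2,3)] by simp
  \<comment> \<open>With both diagonal entries zero, \<open>(C, j, i)\<close> is minimal as well: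
    \<open>C_ji\<close> is \<open>- st C_ij\<close>, of equal degree and nonzero at 0.\<close>
  have "P (C, i, j)" "P (C, j, i)" "deg (C, i, j) \<le> deg z" "deg (C, j, i) \<le> deg z"
    unfolding P_def deg_def Bi using cong C Cji Pd pq(4,5) by auto
  note dvds = dvd [OF this(1,3)] dvd [OF this(2,4)]
  obtain m where m: "n = 2 + m" using Pd(2-4) by (metis less_2_cases_iff le_iff_add linorder_not_less less_one not_less_zero linorder_neq_iff less_trans)
  have "eherm (- 1) n C" using eherm_congruent [OF A cong] by simp
  hence "block_reducible n C"
    unfolding m using Pd(2-4) C dvds IH unfolding m by (intro split_off_hyperbolic [of "- 1" m C i j]) auto
  thus ?thesis using block_reducible_congruent Ac cong by blast
qed

section \<open>Powers of t and the induction on the size\<close>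

lemma smult_diag_block_mat:
  "c \<cdot>\<^sub>m diag_block_mat Bs = diag_block_mat (map ((\<cdot>\<^sub>m) c) (Bs :: 'a::comm_ring_1 mat list))"
proof (induction Bs)
  case (Cons B Bs)
  show ?case
    unfolding list.map diag_block_mat.simps Let_def Cons.IH [symmetric]
    by (intro eq_matI) auto
qed auto

text \<open>Scalars commute with congruence, and a scaled block keeps its zero diagonal. This
  restores a factor \<open>t\<close> that was divided out.\<close>

lemma block_reducible_smult:
  assumes "A \<in> carrier_mat n n" "block_reducible n A"
  shows "block_reducible n (c \<cdot>\<^sub>m A)"
proof -
  obtain Bs where Bs: "\<forall>M\<in>set Bs. admissible_block M" "congruent_pmat n A (diag_block_mat Bs)"
    using assms(2) unfolding block_reducible_def by blast
  obtain S T where S: "S \<in> carrier_mat n n" "T \<in> carrier_mat n n" "S * T = 1\<^sub>m n" "T * S = 1\<^sub>m n"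
    "diag_block_mat Bs = star_mat S * A * S" using Bs(2) by (rule congruentE)
  have "star_mat S * (c \<cdot>\<^sub>m A) * S = c \<cdot>\<^sub>m (star_mat S * A) * S"
    using S assms by (intro arg_cong [of _ _ "\<lambda>M. M * S"] mult_smult_distrib) auto
  also have "\<dots> = c \<cdot>\<^sub>m (star_mat S * A * S)"
    by (intro mult_smult_assoc_mat [of _ n n] mult_carrier_mat [of _ n n]) (use S assms in auto)
  finally have "congruent_pmat n (c \<cdot>\<^sub>m A) (diag_block_mat (map ((\<cdot>\<^sub>m) c) Bs))"
    using congruentI [OF S(1-4), of "c \<cdot>\<^sub>m A"] unfolding smult_diag_block_mat [symmetric] S(5) by simp
  moreover have "\<forall>M\<in>set (map ((\<cdot>\<^sub>m) c) Bs). admissible_block M"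
    using Bs(1) by (auto simp: admissible_block_def)
  ultimately show ?thesis unfolding block_reducible_def by blast
qed

text \<open>The outer induction is on the size. The inner one is on the degree of a fixed nonzero
  entry, which drops when \<open>t\<close> is divided out; \<open>e\<close> varies because this
  division changes its sign.\<close>

lemma eherm_block_reducible:
  fixes A :: "'a::alg_closed_field poly mat"
  assumes two: "(2::'a) \<noteq> 0"
  shows "eherm e n A \<Longrightarrow> e = 1 \<or> e = - 1 \<Longrightarrow> block_reducible n A"
proof (induction n arbitrary: A e rule: less_induct)
  case (less n)
  show ?case
  proof (cases "\<exists>i<n. \<exists>j<n. A $$ (i, j) \<noteq> 0")
    case True
    then obtain i j where ij: "i < n" "j < n" "A $$ (i, j) \<noteq> 0" by blast
    show ?thesis using less.prems ij(3)
    proof (induction "degree (A $$ (i, j))" arbitrary: A e rule: less_induct)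
      case inner: less
      show ?case
      proof (cases "\<exists>k<n. \<exists>l<n. poly (A $$ (k, l)) 0 \<noteq> 0")
        case True
        then obtain k l where kl: "k < n" "l < n" "poly (A $$ (k, l)) 0 \<noteq> 0" by blast
        show ?thesis
        proof (cases "e = 1")
          case True
          obtain m where m: "n = Suc m" using ij by (cases n) auto
          show ?thesis unfolding m
            by (rule hermitian_step [OF two, of m A k l]) (use inner.prems True kl less.IH m in auto)
        next
          case False
          thus ?thesis using inner.prems kl less.IH by (intro skew_step [OF two, of n A k l]) auto
        qed
      next
        case False
        have Ac: "A \<in> carrier_mat n n" and Ah: "\<And>k l. k < n \<Longrightarrow> l < n \<Longrightarrow> st (A $$ (k, l)) = e * A $$ (l, k)"
          using inner.prems by (auto simp: eherm_def)
        have "\<exists>q. A $$ (k, l) = tvar * q" if "k < n" "l < n" for k l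
          using False that tvar_factor by metis
        then obtain q where q: "\<And>k l. k < n \<Longrightarrow> l < n \<Longrightarrow> A $$ (k, l) = tvar * q k l" by metis
        define B where "B = mat n n (\<lambda>(k, l). q k l)"
        have AB: "A = tvar \<cdot>\<^sub>m B" using Ac q by (intro eq_matI) (auto simp: B_def)
        have "st (q k l) = - e * q l k" if "k < n" "l < n" for k l
        proof -
          have "tvar * st (q k l) = tvar * (- e * q l k)"
            using Ah [OF that] unfolding q [OF that] q [OF that(2,1)]
            by (simp add: algebra_simps) (metis minus_minus)
          thus ?thesis by (metis mult_left_cancel tvar_neq_0)
        qed
        hence "eherm (- e) n B" by (simp add: eherm_def B_def)
        moreover have "- e = 1 \<or> - e = - 1" using inner.prems by auto
        moreover have "q i j \<noteq> 0" using inner.prems(3) q ij by auto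
        moreover from this have "degree (q i j) < degree (A $$ (i, j))"
          unfolding q [OF ij(1,2)] by (simp add: degree_mult_eq)
        ultimately have "block_reducible n B"
          using inner.hyps [of B "- e"] ij by (simp add: B_def)
        thus ?thesis unfolding AB by (intro block_reducible_smult) (auto simp: B_def)
      qed
    qed
  next
    case False
    show ?thesis
    proof (cases n)
      case 0
      hence A: "A = diag_block_mat []" using less.prems by (intro eq_matI) (auto simp: eherm_def)
      have "congruent_pmat n A A" using less.prems by (intro congruent_refl) (simp add: eherm_def)
      thus ?thesis unfolding block_reducible_def A by (intro exI [of _ "[]"]) simp
    next
      case (Suc m)
      \<comment> \<open>For the zero matrix the diagonal entry 0 divides the zeros of its row and
        splits off.\<close>
      show ?thesis unfolding Suc
        by (rule split_off_entry [of e m A 0]) (use less False Suc in auto)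
    qed
  qed
qed

theorem theorem4p3:
  fixes A :: "'a::alg_closed_field poly mat" and n :: nat
  assumes char: "(2::'a) \<noteq> 0"
    and A: "A \<in> carrier_mat n n"
    and herm: "hermitian_pmat A \<or> skew_hermitian_pmat A"
  shows "\<exists>Bs. (\<forall>M \<in> set Bs. admissible_block M) \<and>
             congruent_pmat n A (diag_block_mat Bs)"
proof -
  have st: "st (A $$ (i, j)) = star_mat A $$ (j, i)" if "i < n" "j < n" for i j
    using A that by simp
  have "eherm 1 n A \<or> eherm (- 1) n A"
    using herm
  proof
    assume "hermitian_pmat A"
    hence "star_mat A = A" by (simp add: hermitian_pmat_def)
    thus ?thesis using A st by (simp add: eherm_def)
  next
    assume "skew_hermitian_pmat A"
    hence "star_mat A = - A" by (simp add: skew_hermitian_pmat_def)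
    thus ?thesis using A st by (simp add: eherm_def)
  qed
  thus ?thesis using eherm_block_reducible [OF char] unfolding block_reducible_def by blast
qed

end
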